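(* Let $X$ be a complex manifold with associated almost complex structure $J$, let $\pi_R,\pi_I\in\Gamma(\wedge^2TX)$ be real bivector fields, and let $\pi=\pi_R+i\pi_I\in\Gamma(\wedge^2T_{\mathbb C}X)$. The following are equivalent: (a) $\pi=\pi_R+i\pi_I$ is a section of $\wedge^2T^{1,0}X$ and is a holomorphic Poisson bivector field; (b) $(\pi_I,J)$ is a Poisson Nijenhuis structure on $X$ and $\pi_R^\sharp=\pi_I^\sharp\circ J^*$; (c) the endomorphism $$\mathbb J_\pi=\begin{pmatrix}J&\pi_I^\sharp\\0&-J^*\end{pmatrix}$$ of $TX\oplus T^*X$ is a generalized complex structure and $\pi_R^\sharp=\pi_I^\sharp\circ J^*$.
   Context: $T_{\mathbb C}X=TX\otimes\mathbb C$; $T^{1,0}X$ is the $+i$-eigenbundle of $J$. A holomorphic Poisson bivector field is $\pi\in\Gamma(\wedge^2T^{1,0}X)$ with $\bar\partial\pi=0$ and $[\pi,\pi]=0$ (Schouten bracket). For a bivector field $P$, $P^\sharp:T^*X\to TX$ is defined by $\langle\beta,P^\sharp\alpha\rangle=P(\alpha,\beta)$, and $J^*\alpha=\alpha\circ J$. For a bivector field $P$ on a manifold and 1-forms $\alpha,\beta$, put $[\alpha,\beta]_P=\mathcal L_{P^\sharp\alpha}\beta-\mathcal L_{P^\sharp\beta}\alpha-d(P(\alpha,\beta))$. A Poisson Nijenhuis structure on a manifold $X$ is a pair $(P,N)$ where $P$ is a Poisson bivector field, $N:TX\to TX$ is a $(1,1)$-tensor with vanishing Nijenhuis torsion ($[NV,NW]-N([NV,W]+[V,NW]-N[V,W])=0$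 for all vector fields $V,W$), such that $N\circ P^\sharp=P^\sharp\circ N^*$ and, with $P_N$ the bivector field defined by $P_N^\sharp=P^\sharp\circ N^*$, $$[\alpha,\beta]_{P_N}=[N^*\alpha,\beta]_P+[\alpha,N^*\beta]_P-N^*[\alpha,\beta]_P$$ for all 1-forms $\alpha,\beta$. A generalized complex structure on $X$ is a bundle endomorphism $\mathbb J$ of $TX\oplus T^*X$ with $\mathbb J^2=-\mathrm{id}$, orthogonal for the pairing $\langle V+\xi,W+\eta\rangle=\frac12(\xi(W)+\eta(V))$, whose $\pm i$-eigenbundles in $(TX\oplus T^*X)\otimes\mathbb C$ have spaces of sections closed under the Courant bracket $[\![V+\xi,W+\eta]\!]=[V,W]+\mathcal L_V\eta-\mathcal L_W\xi+\frac12d(\xi(W)-\eta(V))$. *)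

theory Defs
  imports "HOL-Analysis.Analysis"
begin

section \<open>Smooth maps between Euclidean spaces\<close>

text \<open>The full derivative as an element of the space of linear maps.\<close>

definition FD :: "('e::euclidean_space \<Rightarrow> 'b::real_normed_vector) \<Rightarrow> 'e \<Rightarrow> 'e \<Rightarrow>\<^sub>L 'b" where
  "FD f x = Blinfun (frechet_derivative f (at x))"

lemma FD_apply: "f differentiable (at x) \<Longrightarrow> blinfun_apply (FD f x) = frechet_derivative f (at x)"
  unfolding FD_def
  by (rule bounded_linear_Blinfun_apply)
    (metis frechet_derivative_works has_derivative_bounded_linear)

lemma FD_eqI: "(f has_derivative f') (at x) \<Longrightarrow> blinfun_apply (FD f x) = f'"
  by (metis FD_apply differentiableI frechet_derivative_at)

primrec Ck_on :: "nat \<Rightarrow> 'e::euclidean_space set \<Rightarrow> ('e \<Rightarrow> 'b::real_normed_vector) \<Rightarrow> bool" where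
  "Ck_on 0 S f \<longleftrightarrow> continuous_on S f"
| "Ck_on (Suc k) S f \<longleftrightarrow>
    (\<forall>x\<in>S. f differentiable (at x)) \<and> (\<forall>v. Ck_on k S (\<lambda>x. FD f x v))"

text \<open>Only used for open sets \<open>S\<close>.\<close>

definition smooth_on :: "'e::euclidean_space set \<Rightarrow> ('e \<Rightarrow> 'b::real_normed_vector) \<Rightarrow> bool" where
  "smooth_on S f \<longleftrightarrow> (\<forall>k. Ck_on k S f)"


section \<open>Complexification\<close>

text \<open>
  The complexification of a real vector space \<open>'v\<close> is \<open>'v \<times> 'v\<close>, the pair \<open>(a, b)\<close> standing for
  \<open>a + i b\<close>. (In a chart the tangent space is \<open>complex ^ 'n\<close> regarded as a real vector space; its
  complexification is the space of pairs and must not be confused with \<open>complex ^ 'n\<close> itself.)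
  A complex section of a complexified bundle is likewise a pair of real sections.
\<close>

type_synonym 'v cx = "'v \<times> 'v"

definition cx_scale :: "complex \<Rightarrow> 'v::real_vector cx \<Rightarrow> 'v cx" where
  "cx_scale z Z = (Re z *\<^sub>R fst Z - Im z *\<^sub>R snd Z, Re z *\<^sub>R snd Z + Im z *\<^sub>R fst Z)"

definition cx_map :: "('v \<Rightarrow> 'w) \<Rightarrow> 'v cx \<Rightarrow> 'w cx" where
  "cx_map f Z = (f (fst Z), f (snd Z))"

text \<open>The complex bilinear extension of a real bilinear operation.\<close>

definition cx_bilin :: "('u \<Rightarrow> 'v \<Rightarrow> 'w::real_vector) \<Rightarrow> 'u cx \<Rightarrow> 'v cx \<Rightarrow> 'w cx" where
  "cx_bilin f S T =
    (f (fst S) (fst T) - f (snd S) (snd T), f (fst S) (snd T) + f (snd S) (fst T))"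

definition cx_number :: "real cx \<Rightarrow> complex" where
  "cx_number r = Complex (fst r) (snd r)"


section \<open>Linear algebra of a tangent space\<close>

type_synonym 'e covector = "'e \<Rightarrow>\<^sub>L real"

text \<open>
  Elements of the second exterior power of \<open>'e\<close> are alternating bilinear forms on the dual space;
  being alternating is imposed in \<open>bivector_field\<close> below.
\<close>

type_synonym 'e bivector = "'e covector \<Rightarrow>\<^sub>L 'e covector \<Rightarrow>\<^sub>L real"

definition wedge :: "'e::euclidean_space \<Rightarrow> 'e \<Rightarrow> 'e bivector" where
  "wedge v w = Blinfun (\<lambda>\<alpha>::'e covector. Blinfun (\<lambda>\<beta>::'e covector. \<alpha> v * \<beta> w - \<alpha> w * \<beta> v))"

lemma wedge_apply:
  fixes v w :: "'a::euclidean_space" and \<alpha> \<beta> :: "'a covector"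
  shows "wedge v w \<alpha> \<beta> = \<alpha> v * \<beta> w - \<alpha> w * \<beta> v"
proof -
  let ?g = "\<lambda>\<alpha>::'a covector. \<alpha> v *\<^sub>R blinfun.prod_left w - \<alpha> w *\<^sub>R blinfun.prod_left v :: 'a covector \<Rightarrow>\<^sub>L real"
  have 1: "Blinfun (\<lambda>\<beta>::'a covector. \<alpha> v * \<beta> w - \<alpha> w * \<beta> v) = ?g \<alpha>" for \<alpha> :: "'a covector"
    by (rule blinfun_eqI, subst bounded_linear_Blinfun_apply)
      (auto simp: blinfun.bilinear_simps intro!: bounded_linear_intros)
  have 2: "bounded_linear ?g"
    by (intro bounded_linear_intros)
  show ?thesis
    unfolding wedge_def 1
    by (subst bounded_linear_Blinfun_apply[OF 2]) (simp add: blinfun.bilinear_simps)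
qed

text \<open>The vector \<open>sharp P \<alpha>\<close> is characterized by \<open>\<langle>\<beta>, sharp P \<alpha>\<rangle> = P(\<alpha>, \<beta>)\<close>.\<close>

definition sharp :: "'e::euclidean_space bivector \<Rightarrow> 'e covector \<Rightarrow> 'e" where
  "sharp P \<alpha> = (THE v. \<forall>\<beta>. blinfun_apply \<beta> v = P \<alpha> \<beta>)"

lemma covectors_separate:
  assumes "\<And>\<beta> :: 'e::euclidean_space covector. \<beta> v = \<beta> w"
  shows "v = w"
proof (rule euclidean_eqI)
  fix b :: 'e
  show "v \<bullet> b = w \<bullet> b"
    using assms[of "blinfun_inner_left b"] by (simp add: inner_commute)
qed

lemma sharp_apply:
  fixes P :: "'e::euclidean_space bivector"
  shows "blinfun_apply \<beta> (sharp P \<alpha>) = P \<alpha> \<beta>"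
proof -
  let ?v = "\<Sum>e\<in>Basis. P \<alpha> (blinfun_inner_left e) *\<^sub>R e"
  have *: "blinfun_apply \<beta> ?v = P \<alpha> \<beta>" for \<beta>
  proof -
    have "\<beta> = (\<Sum>e\<in>Basis. \<beta> e *\<^sub>R blinfun_inner_left e)"
      by (rule blinfun_euclidean_eqI)
        (simp add: blinfun.bilinear_simps blinfun.sum_left inner_Basis if_distrib cong: if_cong)
    then have "P \<alpha> \<beta> = P \<alpha> (\<Sum>e\<in>Basis. \<beta> e *\<^sub>R blinfun_inner_left e)"
      by simp
    then show ?thesis
      by (simp add: blinfun.bilinear_simps blinfun.sum_right mult.commute)
  qed
  have "\<forall>\<beta>. blinfun_apply \<beta> (sharp P \<alpha>) = P \<alpha> \<beta>"
    unfolding sharp_def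
  proof (rule theI)
    show "\<forall>\<beta>. blinfun_apply \<beta> ?v = P \<alpha> \<beta>"
      by (intro allI *)
  next
    fix w assume "\<forall>\<beta>. blinfun_apply \<beta> w = P \<alpha> \<beta>"
    then have "\<beta> w = \<beta> ?v" for \<beta> :: "'e covector"
      unfolding * by blast
    then show "w = ?v"
      by (rule covectors_separate)
  qed
  then show ?thesis ..
qed

lemma sharp_eqI:
  fixes P :: "'e::euclidean_space bivector"
  shows "(\<And>\<beta>. blinfun_apply \<beta> v = P \<alpha> \<beta>) \<Longrightarrow> sharp P \<alpha> = v"
  by (rule covectors_separate) (simp add: sharp_apply)

text \<open>The transpose \<open>N\<^sup>* \<alpha> = \<alpha> \<circ> N\<close> of an endomorphism.\<close>

definition dual_map :: "('e::euclidean_space \<Rightarrow>\<^sub>L 'e) \<Rightarrow> 'e covector \<Rightarrow>\<^sub>L 'e covector" where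
  "dual_map N = Blinfun (\<lambda>\<alpha>. \<alpha> o\<^sub>L N)"

lemma dual_map_apply:
  fixes N :: "'e::euclidean_space \<Rightarrow>\<^sub>L 'e"
  shows "dual_map N \<alpha> = \<alpha> o\<^sub>L N"
  unfolding dual_map_def
  by (subst bounded_linear_Blinfun_apply) (auto intro!: bounded_linear_intros)

text \<open>The standard complex structure, multiplication by \<open>i\<close>.\<close>

definition J0 :: "(complex ^ 'n::finite) \<Rightarrow>\<^sub>L (complex ^ 'n)" where
  "J0 = Blinfun (\<lambda>v. \<i> *s v)"

lemma J0_apply: "J0 v = \<i> *s v"
  unfolding J0_def
  by (subst bounded_linear_Blinfun_apply)
    (auto intro!: linear_conv_bounded_linear[THEN iffD1] linearI
      simp: vec_eq_iff algebra_simps)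


section \<open>Differential calculus in a chart\<close>

text \<open>The usual formulas, for tensor fields on an open subset of \<open>'e\<close>.\<close>

definition lie_bracket :: "('e::euclidean_space \<Rightarrow> 'e) \<Rightarrow> ('e \<Rightarrow> 'e) \<Rightarrow> 'e \<Rightarrow> 'e" where
  "lie_bracket V W x = FD W x (V x) - FD V x (W x)"

text \<open>\<open>(L\<^sub>V \<beta>)(w) = V(\<beta>(w)) - \<beta>([V, w])\<close> for constant \<open>w\<close>, where \<open>[V, w] = - DV(w)\<close>.\<close>

definition lie_form :: "('e::euclidean_space \<Rightarrow> 'e) \<Rightarrow> ('e \<Rightarrow> 'e covector) \<Rightarrow> 'e \<Rightarrow> 'e covector" where
  "lie_form V \<beta> x = FD \<beta> x (V x) + (\<beta> x o\<^sub>L FD V x)"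

definition koszul_bracket ::
  "('e::euclidean_space \<Rightarrow> 'e bivector) \<Rightarrow> ('e \<Rightarrow> 'e covector) \<Rightarrow> ('e \<Rightarrow> 'e covector) \<Rightarrow> 'e \<Rightarrow> 'e covector"
where
  "koszul_bracket P \<alpha> \<beta> x =
     lie_form (\<lambda>y. sharp (P y) (\<alpha> y)) \<beta> x - lie_form (\<lambda>y. sharp (P y) (\<beta> y)) \<alpha> x
       - FD (\<lambda>y. P y (\<alpha> y) (\<beta> y)) x"

text \<open>
  The Schouten bracket of two bivector fields, as a trilinear form on covectors. In coordinates:
  \<open>[P,Q]\<^sup>i\<^sup>j\<^sup>k\<close> is, up to the sign convention, the cyclic sum over \<open>(i,j,k)\<close> of
  \<open>P\<^sup>i\<^sup>l \<partial>\<^sub>l Q\<^sup>j\<^sup>k + Q\<^sup>i\<^sup>l \<partial>\<^sub>l P\<^sup>j\<^sup>k\<close>. The lemma \<open>schouten_wedge\<close> identifies it with the extension of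
  the Lie bracket to decomposable bivector fields.
\<close>

definition schouten_term ::
  "('e::euclidean_space \<Rightarrow> 'e bivector) \<Rightarrow> ('e \<Rightarrow> 'e bivector) \<Rightarrow> 'e \<Rightarrow>
    'e covector \<Rightarrow> 'e covector \<Rightarrow> 'e covector \<Rightarrow> real" where
  "schouten_term P Q x a b c =
     FD (\<lambda>y. Q y b c) x (sharp (P x) a) + FD (\<lambda>y. P y b c) x (sharp (Q x) a)"

definition schouten ::
  "('e::euclidean_space \<Rightarrow> 'e bivector) \<Rightarrow> ('e \<Rightarrow> 'e bivector) \<Rightarrow> 'e \<Rightarrow>
    'e covector \<Rightarrow> 'e covector \<Rightarrow> 'e covector \<Rightarrow> real" where
  "schouten P Q x a b c =
     schouten_term P Q x a b c + schouten_term P Q x b c a + schouten_term P Q x c a b"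

definition wedge3 ::
  "'e::euclidean_space \<Rightarrow> 'e \<Rightarrow> 'e \<Rightarrow> 'e covector \<Rightarrow> 'e covector \<Rightarrow> 'e covector \<Rightarrow> real" where
  "wedge3 u v w a b c =
     a u * wedge v w b c + b u * wedge v w c a + c u * wedge v w a b"

lemma schouten_wedge:
  fixes v1 v2 w1 w2 :: "'e::euclidean_space \<Rightarrow> 'e"
  assumes "v1 differentiable (at x)" "v2 differentiable (at x)"
    and "w1 differentiable (at x)" "w2 differentiable (at x)"
  shows "schouten (\<lambda>y. wedge (v1 y) (v2 y)) (\<lambda>y. wedge (w1 y) (w2 y)) x a b c =
      wedge3 (lie_bracket v1 w1 x) (v2 x) (w2 x) a b c
    - wedge3 (lie_bracket v1 w2 x) (v2 x) (w1 x) a b c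
    - wedge3 (lie_bracket v2 w1 x) (v1 x) (w2 x) a b c
    + wedge3 (lie_bracket v2 w2 x) (v1 x) (w1 x) a b c"
proof -
  have sharp: "sharp (wedge v w) a = a v *\<^sub>R w - a w *\<^sub>R v" for v w :: 'e and a
    by (rule sharp_eqI) (simp add: wedge_apply blinfun.bilinear_simps)
  have D: "FD (\<lambda>y. wedge (v y) (w y) b c) x h =
      b (FD v x h) * c (w x) + b (v x) * c (FD w x h)
      - b (FD w x h) * c (v x) - b (w x) * c (FD v x h)"
    if "v differentiable (at x)" "w differentiable (at x)" for v w :: "'e \<Rightarrow> 'e" and b c h
  proof -
    have d: "(v has_derivative FD v x) (at x)" "(w has_derivative FD w x) (at x)"
      using that by (simp_all add: FD_apply frechet_derivative_works[symmetric])
    have "((\<lambda>y. b (v y) * c (w y) - b (w y) * c (v y)) has_derivative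
        (\<lambda>h. (b (v x) * c (FD w x h) + b (FD v x h) * c (w x))
           - (b (w x) * c (FD v x h) + b (FD w x h) * c (v x)))) (at x)"
      by (intro has_derivative_diff has_derivative_mult
          bounded_linear.has_derivative[OF blinfun.bounded_linear_right] d)
    from FD_eqI[OF this] show ?thesis
      by (simp add: wedge_apply)
  qed
  show ?thesis
    unfolding schouten_def schouten_term_def wedge3_def lie_bracket_def
      sharp D[OF assms(1,2)] D[OF assms(3,4)]
    by (simp add: wedge_apply blinfun.bilinear_simps algebra_simps)
qed

definition courant_bracket ::
  "('e::euclidean_space \<Rightarrow> 'e \<times> 'e covector) \<Rightarrow> ('e \<Rightarrow> 'e \<times> 'e covector) \<Rightarrow> 'e \<Rightarrow> 'e \<times> 'e covector"
where
  "courant_bracket s t x =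
    (let V = (\<lambda>y. fst (s y)); \<xi> = (\<lambda>y. snd (s y)); W = (\<lambda>y. fst (t y)); \<eta> = (\<lambda>y. snd (t y))
     in (lie_bracket V W x,
         lie_form V \<eta> x - lie_form W \<xi> x + (1/2) *\<^sub>R FD (\<lambda>y. \<xi> y (W y) - \<eta> y (V y)) x))"

definition pairing :: "'e::euclidean_space \<times> 'e covector \<Rightarrow> 'e \<times> 'e covector \<Rightarrow> real" where
  "pairing u w = (1/2) * (snd u (fst w) + snd w (fst u))"

text \<open>The value at \<open>v\<close> of the \<open>(0,1)\<close>-part of \<open>df\<close>.\<close>

definition dbar :: "(complex ^ 'n::finite \<Rightarrow> complex) \<Rightarrow> complex ^ 'n \<Rightarrow> complex ^ 'n \<Rightarrow> complex" where
  "dbar f x v = (1/2) * (FD f x v + \<i> * FD f x (J0 v))"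


section \<open>Complex manifolds and tensor fields\<close>

text \<open>A chart is a pair of its domain and its coordinate map.\<close>

type_synonym ('a, 'n) chart = "'a set \<times> ('a \<Rightarrow> complex ^ 'n)"

definition chart_image :: "('a, 'n) chart \<Rightarrow> (complex ^ 'n) set" where
  "chart_image c = snd c ` fst c"

text \<open>The image under \<open>c\<close> of the intersection of the two chart domains.\<close>

definition overlap :: "('a, 'n) chart \<Rightarrow> ('a, 'n) chart \<Rightarrow> (complex ^ 'n) set" where
  "overlap c d = snd c ` (fst c \<inter> fst d)"

definition transition :: "('a, 'n) chart \<Rightarrow> ('a, 'n) chart \<Rightarrow> complex ^ 'n \<Rightarrow> complex ^ 'n" where
  "transition c d x = snd d (inv_into (fst c) (snd c) x)"

definition jac :: "('a, 'n::finite) chart \<Rightarrow> ('a, 'n) chart \<Rightarrow> complex ^ 'n \<Rightarrow> (complex ^ 'n) \<Rightarrow>\<^sub>L (complex ^ 'n)" where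
  "jac c d x = FD (transition c d) x"

text \<open>
  A holomorphic atlas on the whole (Hausdorff, second countable) space \<open>'a\<close>. Holomorphic maps are
  the smooth maps whose real derivative commutes with multiplication by \<open>i\<close> (Cauchy-Riemann).
\<close>

definition complex_manifold ::
  "('a::{t2_space, second_countable_topology}, 'n::finite) chart set \<Rightarrow> bool" where
  "complex_manifold A \<longleftrightarrow>
     (\<Union>c\<in>A. fst c) = UNIV \<and>
     (\<forall>c\<in>A. open (fst c) \<and> open (chart_image c) \<and>
        (\<exists>g. homeomorphism (fst c) (chart_image c) (snd c) g)) \<and>
     (\<forall>c\<in>A. \<forall>d\<in>A. smooth_on (overlap c d) (transition c d) \<and>
        (\<forall>x\<in>overlap c d. jac c d x o\<^sub>L J0 = J0 o\<^sub>L jac c d x))"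

text \<open>
  A tensor field on the manifold with atlas \<open>A\<close> is the family of its coordinate representations,
  one for each chart in \<open>A\<close>, subject to the transformation law on overlaps. The representation
  in \<open>c\<close> is a function on \<open>chart_image c\<close>; its values elsewhere are irrelevant.
  A chart with values in \<open>complex ^ 'n\<close> is at the same time a chart of the underlying real
  manifold, of dimension \<open>2 * CARD('n)\<close>.
\<close>

definition vector_field ::
  "('a, 'n::finite) chart set \<Rightarrow> (('a, 'n) chart \<Rightarrow> complex ^ 'n \<Rightarrow> complex ^ 'n) \<Rightarrow> bool" where
  "vector_field A V \<longleftrightarrow>
     (\<forall>c\<in>A. smooth_on (chart_image c) (V c)) \<and>
     (\<forall>c\<in>A. \<forall>d\<in>A. \<forall>x\<in>overlap c d. V d (transition c d x) = jac c d x (V c x))"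

definition one_form ::
  "('a, 'n::finite) chart set \<Rightarrow> (('a, 'n) chart \<Rightarrow> complex ^ 'n \<Rightarrow> (complex ^ 'n) covector) \<Rightarrow> bool" where
  "one_form A \<alpha> \<longleftrightarrow>
     (\<forall>c\<in>A. smooth_on (chart_image c) (\<alpha> c)) \<and>
     (\<forall>c\<in>A. \<forall>d\<in>A. \<forall>x\<in>overlap c d. \<alpha> c x = \<alpha> d (transition c d x) o\<^sub>L jac c d x)"

definition bivector_field ::
  "('a, 'n::finite) chart set \<Rightarrow> (('a, 'n) chart \<Rightarrow> complex ^ 'n \<Rightarrow> (complex ^ 'n) bivector) \<Rightarrow> bool" where
  "bivector_field A P \<longleftrightarrow>
     (\<forall>c\<in>A. smooth_on (chart_image c) (P c)) \<and>
     (\<forall>c\<in>A. \<forall>x\<in>chart_image c. \<forall>a. P c x a a = 0) \<and>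
     (\<forall>c\<in>A. \<forall>d\<in>A. \<forall>x\<in>overlap c d. \<forall>a b.
        P d (transition c d x) a b = P c x (a o\<^sub>L jac c d x) (b o\<^sub>L jac c d x))"

text \<open>\<open>(1,1)\<close>-tensors.\<close>

definition endo_field ::
  "('a, 'n::finite) chart set \<Rightarrow> (('a, 'n) chart \<Rightarrow> complex ^ 'n \<Rightarrow> (complex ^ 'n) \<Rightarrow>\<^sub>L (complex ^ 'n)) \<Rightarrow> bool" where
  "endo_field A N \<longleftrightarrow>
     (\<forall>c\<in>A. smooth_on (chart_image c) (N c)) \<and>
     (\<forall>c\<in>A. \<forall>d\<in>A. \<forall>x\<in>overlap c d.
        N d (transition c d x) o\<^sub>L jac c d x = jac c d x o\<^sub>L N c x)"

text \<open>The almost complex structure: in holomorphic coordinates it is multiplication by \<open>i\<close>.\<close>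

definition Jfield :: "('a, 'n::finite) chart \<Rightarrow> complex ^ 'n \<Rightarrow> (complex ^ 'n) \<Rightarrow>\<^sub>L (complex ^ 'n)" where
  "Jfield c x = J0"


section \<open>Holomorphic Poisson bivector fields\<close>

definition T10 :: "((complex ^ 'n::finite) \<Rightarrow>\<^sub>L (complex ^ 'n)) \<Rightarrow> (complex ^ 'n) cx set" where
  "T10 J = {Z. cx_map J Z = cx_scale \<i> Z}"

text \<open>
  The second exterior power of the \<open>+i\<close>-eigenspace. As the latter is closed under \<open>cx_scale\<close>, the
  real span below is the complex span.
\<close>

definition wedge2_T10 :: "((complex ^ 'n::finite) \<Rightarrow>\<^sub>L (complex ^ 'n)) \<Rightarrow> (complex ^ 'n) bivector cx set" where
  "wedge2_T10 J = span {cx_bilin wedge Z W | Z W. Z \<in> T10 J \<and> W \<in> T10 J}"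

text \<open>The complex covector \<open>dz\<^sub>j = dx\<^sub>j + i dy\<^sub>j\<close>.\<close>

definition dz :: "'n::finite \<Rightarrow> (complex ^ 'n) covector cx" where
  "dz j = (blinfun_inner_left (axis j 1), blinfun_inner_left (axis j \<i>))"

lemma dz_apply: "cx_number (fst (dz j) v, snd (dz j) v) = v $ j"
  by (simp add: dz_def cx_number_def inner_axis complex_eq_iff inner_complex_def)

text \<open>
  The coefficient \<open>\<pi>\<^sup>j\<^sup>k = \<pi>(dz\<^sub>j, dz\<^sub>k)\<close> of \<open>\<partial>\<^sub>j \<and> \<partial>\<^sub>k\<close> in the complex bivector \<open>\<pi>\<close> (the pair of its real
  and imaginary parts), with \<open>\<pi>\<close> extended complex bilinearly to complex covectors.
\<close>

definition holo_coeff :: "(complex ^ 'n::finite) bivector cx \<Rightarrow> 'n \<Rightarrow> 'n \<Rightarrow> complex" where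
  "holo_coeff \<pi> j k =
     cx_number (cx_bilin (\<lambda>a b. fst \<pi> a b) (dz j) (dz k))
       + \<i> * cx_number (cx_bilin (\<lambda>a b. snd \<pi> a b) (dz j) (dz k))"

text \<open>
  The operator \<open>dbar\<close> of the holomorphic bundle \<open>\<Lambda>\<^sup>2T\<^sup>1\<^sup>,\<^sup>0\<close> acts on the coefficients with respect to
  the local holomorphic frame \<open>\<partial>\<^sub>j \<and> \<partial>\<^sub>k\<close>.
\<close>

definition holomorphic_poisson ::
  "('a, 'n::finite) chart set \<Rightarrow> (('a, 'n) chart \<Rightarrow> complex ^ 'n \<Rightarrow> (complex ^ 'n) bivector) cx \<Rightarrow> bool" where
  "holomorphic_poisson A \<pi> \<longleftrightarrow>
     bivector_field A (fst \<pi>) \<and> bivector_field A (snd \<pi>) \<and>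
     (\<forall>c\<in>A. \<forall>x\<in>chart_image c. (fst \<pi> c x, snd \<pi> c x) \<in> wedge2_T10 (Jfield c x)) \<and>
     (\<forall>c\<in>A. \<forall>x\<in>chart_image c. \<forall>j k v.
        dbar (\<lambda>y. holo_coeff (fst \<pi> c y, snd \<pi> c y) j k) x v = 0) \<and>
     (\<forall>c\<in>A. \<forall>x\<in>chart_image c. \<forall>a1 a2 a3.
        cx_bilin (\<lambda>P Q. schouten P Q x a1 a2 a3) (fst \<pi> c, snd \<pi> c) (fst \<pi> c, snd \<pi> c) = 0)"


section \<open>Poisson Nijenhuis structures\<close>

definition poisson_bivector_field ::
  "('a, 'n::finite) chart set \<Rightarrow> (('a, 'n) chart \<Rightarrow> complex ^ 'n \<Rightarrow> (complex ^ 'n) bivector) \<Rightarrow> bool" where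
  "poisson_bivector_field A P \<longleftrightarrow>
     bivector_field A P \<and>
     (\<forall>c\<in>A. \<forall>x\<in>chart_image c. \<forall>a1 a2 a3. schouten (P c) (P c) x a1 a2 a3 = 0)"

definition nijenhuis_torsion ::
  "('e::euclidean_space \<Rightarrow> 'e \<Rightarrow>\<^sub>L 'e) \<Rightarrow> ('e \<Rightarrow> 'e) \<Rightarrow> ('e \<Rightarrow> 'e) \<Rightarrow> 'e \<Rightarrow> 'e" where
  "nijenhuis_torsion N V W x =
     (let NV = (\<lambda>y. N y (V y)); NW = (\<lambda>y. N y (W y))
      in lie_bracket NV NW x
         - N x (lie_bracket NV W x + lie_bracket V NW x - N x (lie_bracket V W x)))"

text \<open>
  The bivector \<open>P\<^sub>N\<close> with \<open>P\<^sub>N(\<alpha>, \<beta>) = P(N\<^sup>* \<alpha>, \<beta>)\<close>, i.e. \<open>sharp P\<^sub>N = sharp P \<circ> N\<^sup>*\<close>. It is alternating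
  when \<open>N \<circ> sharp P = sharp P \<circ> N\<^sup>*\<close>.
\<close>

definition twist :: "'e::euclidean_space bivector \<Rightarrow> ('e \<Rightarrow>\<^sub>L 'e) \<Rightarrow> 'e bivector" where
  "twist P N = P o\<^sub>L dual_map N"

lemma sharp_twist:
  fixes P :: "'e::euclidean_space bivector"
  shows "sharp (twist P N) \<alpha> = sharp P (dual_map N \<alpha>)"
  by (rule sharp_eqI) (simp add: twist_def sharp_apply)

definition poisson_nijenhuis ::
  "('a, 'n::finite) chart set \<Rightarrow> (('a, 'n) chart \<Rightarrow> complex ^ 'n \<Rightarrow> (complex ^ 'n) bivector) \<Rightarrow>
    (('a, 'n) chart \<Rightarrow> complex ^ 'n \<Rightarrow> (complex ^ 'n) \<Rightarrow>\<^sub>L (complex ^ 'n)) \<Rightarrow> bool" where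
  "poisson_nijenhuis A P N \<longleftrightarrow>
     poisson_bivector_field A P \<and>
     endo_field A N \<and>
     (\<forall>V W. vector_field A V \<longrightarrow> vector_field A W \<longrightarrow>
        (\<forall>c\<in>A. \<forall>x\<in>chart_image c. nijenhuis_torsion (N c) (V c) (W c) x = 0)) \<and>
     (\<forall>c\<in>A. \<forall>x\<in>chart_image c. \<forall>a. N c x (sharp (P c x) a) = sharp (P c x) (dual_map (N c x) a)) \<and>
     (\<forall>\<alpha> \<beta>. one_form A \<alpha> \<longrightarrow> one_form A \<beta> \<longrightarrow>
        (\<forall>c\<in>A. \<forall>x\<in>chart_image c.
           koszul_bracket (\<lambda>y. twist (P c y) (N c y)) (\<alpha> c) (\<beta> c) x =
             koszul_bracket (P c) (\<lambda>y. dual_map (N c y) (\<alpha> c y)) (\<beta> c) x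
             + koszul_bracket (P c) (\<alpha> c) (\<lambda>y. dual_map (N c y) (\<beta> c y)) x
             - dual_map (N c x) (koszul_bracket (P c) (\<alpha> c) (\<beta> c) x)))"


section \<open>Generalized complex structures\<close>

text \<open>Sections and endomorphisms of the direct sum of the tangent and the cotangent bundle.\<close>

definition gen_section ::
  "('a, 'n::finite) chart set \<Rightarrow>
    (('a, 'n) chart \<Rightarrow> complex ^ 'n \<Rightarrow> (complex ^ 'n) \<times> (complex ^ 'n) covector) \<Rightarrow> bool" where
  "gen_section A s \<longleftrightarrow>
     vector_field A (\<lambda>c x. fst (s c x)) \<and> one_form A (\<lambda>c x. snd (s c x))"

definition gen_transport ::
  "('a, 'n::finite) chart \<Rightarrow> ('a, 'n) chart \<Rightarrow> complex ^ 'n \<Rightarrow>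
    (complex ^ 'n) \<times> (complex ^ 'n) covector \<Rightarrow> (complex ^ 'n) \<times> (complex ^ 'n) covector" where
  "gen_transport c d x u = (jac c d x (fst u), snd u o\<^sub>L jac d c (transition c d x))"

type_synonym 'e gen_endo = "('e \<times> 'e covector) \<Rightarrow>\<^sub>L ('e \<times> 'e covector)"

definition gen_endo_field ::
  "('a, 'n::finite) chart set \<Rightarrow>
    (('a, 'n) chart \<Rightarrow> complex ^ 'n \<Rightarrow> (complex ^ 'n) gen_endo) \<Rightarrow> bool" where
  "gen_endo_field A K \<longleftrightarrow>
     (\<forall>c\<in>A. smooth_on (chart_image c) (K c)) \<and>
     (\<forall>c\<in>A. \<forall>d\<in>A. \<forall>x\<in>overlap c d. \<forall>u.
        K d (transition c d x) (gen_transport c d x u) = gen_transport c d x (K c x u))"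

text \<open>Complex sections of the \<open>z\<close>-eigenbundle of the complexification of \<open>K\<close>.\<close>

definition eigen_section ::
  "('a, 'n::finite) chart set \<Rightarrow> (('a, 'n) chart \<Rightarrow> complex ^ 'n \<Rightarrow> (complex ^ 'n) gen_endo) \<Rightarrow> complex \<Rightarrow>
    (('a, 'n) chart \<Rightarrow> complex ^ 'n \<Rightarrow> (complex ^ 'n) \<times> (complex ^ 'n) covector) cx \<Rightarrow> bool" where
  "eigen_section A K z s \<longleftrightarrow>
     gen_section A (fst s) \<and> gen_section A (snd s) \<and>
     (\<forall>c\<in>A. \<forall>x\<in>chart_image c.
        cx_map (K c x) (fst s c x, snd s c x) = cx_scale z (fst s c x, snd s c x))"

text \<open>
  The Courant bracket of two sections is a section, so that for it to be a section of an
  eigenbundle only means that it takes values in the eigenspaces.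
\<close>

definition generalized_complex ::
  "('a, 'n::finite) chart set \<Rightarrow>
    (('a, 'n) chart \<Rightarrow> complex ^ 'n \<Rightarrow> (complex ^ 'n) gen_endo) \<Rightarrow> bool" where
  "generalized_complex A K \<longleftrightarrow>
     gen_endo_field A K \<and>
     (\<forall>c\<in>A. \<forall>x\<in>chart_image c. \<forall>u. K c x (K c x u) = - u) \<and>
     (\<forall>c\<in>A. \<forall>x\<in>chart_image c. \<forall>u w. pairing (K c x u) (K c x w) = pairing u w) \<and>
     (\<forall>z\<in>{\<i>, -\<i>}. \<forall>s t. eigen_section A K z s \<longrightarrow> eigen_section A K z t \<longrightarrow>
        (\<forall>c\<in>A. \<forall>x\<in>chart_image c.
           let b = cx_bilin (\<lambda>s t. courant_bracket s t x) (fst s c, snd s c) (fst t c, snd t c)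
           in cx_map (K c x) b = cx_scale z b))"

text \<open>The block matrix with rows \<open>(N, sharp P)\<close> and \<open>(0, - N\<^sup>*)\<close>.\<close>

definition block_endo :: "('e::euclidean_space \<Rightarrow>\<^sub>L 'e) \<Rightarrow> 'e bivector \<Rightarrow> 'e gen_endo" where
  "block_endo N P = Blinfun (\<lambda>u. (N (fst u) + sharp P (snd u), - dual_map N (snd u)))"

lemma bounded_linear_sharp:
  fixes P :: "'e::euclidean_space bivector"
  shows "bounded_linear (sharp P)"
proof -
  have "sharp P = (\<lambda>\<alpha>. \<Sum>e\<in>Basis. P \<alpha> (blinfun_inner_left e) *\<^sub>R e)"
  proof
    fix \<alpha>
    have "sharp P \<alpha> \<bullet> e = P \<alpha> (blinfun_inner_left e)" for e
      using sharp_apply[of "blinfun_inner_left e" P \<alpha>] by (simp add: inner_commute)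
    then show "sharp P \<alpha> = (\<Sum>e\<in>Basis. P \<alpha> (blinfun_inner_left e) *\<^sub>R e)"
      by (metis (no_types, lifting) euclidean_representation sum.cong)
  qed
  then show ?thesis
    by (auto intro!: bounded_linear_intros)
qed

lemma block_endo_apply:
  fixes P :: "'e::euclidean_space bivector"
  shows "block_endo N P u = (N (fst u) + sharp P (snd u), - dual_map N (snd u))"
  unfolding block_endo_def
  by (subst bounded_linear_Blinfun_apply)
    (auto intro!: bounded_linear_intros bounded_linear_minus bounded_linear_compose[OF bounded_linear_sharp]
      bounded_linear_compose[OF blinfun.bounded_linear_right])

end

theory Submission
  imports Defs
begin

text \<open>
  Each of the three conditions is reduced to the same pair of statements about \<open>\<pi>I\<close> in holomorphic
  coordinates, where \<open>J\<close> is the constant matrix \<open>J0\<close>. Write \<open>D u\<close> for the derivative of the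
  coefficients of \<open>\<pi>I\<close> in the direction \<open>u\<close>. The pair consists of the Cauchy-Riemann condition
  \<open>D (J u) a b = D u (J\<^sup>* a) b\<close> and of the Jacobi identity \<open>[\<pi>I, \<pi>I] = 0\<close>.

  The algebraic condition comes first. A bivector \<open>R + i I\<close> lies in \<open>\<Lambda>\<^sup>2T\<^sup>1\<^sup>,\<^sup>0\<close> exactly when
  \<open>R(a, b) = I(J\<^sup>* a, b)\<close> (\<open>wedge2_T10_iff\<close>), which is the relation between the sharp maps in the
  other two conditions. Since \<open>R\<close> is alternating, this relation contains the compatibility
  \<open>J I\<^sup>\<sharp> = I\<^sup>\<sharp> J\<^sup>*\<close>. From here on it is assumed.

  Holomorphic Poisson: the coefficients \<open>\<pi>(dz\<^sub>j, dz\<^sub>k)\<close> are \<open>4 (R + i I)(dx\<^sub>j, dx\<^sub>k)\<close>, so they are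
  holomorphic if and only if the Cauchy-Riemann condition holds (\<open>dbar_holo_coeff_eq_0_iff\<close>). Under
  it, \<open>[R, R] = - [I, I]\<close> and \<open>[R, I](a, b, c) = [I, I](J\<^sup>* a, b, c)\<close>, so \<open>[\<pi>, \<pi>] = 0\<close> is
  equivalent to \<open>[I, I] = 0\<close> (\<open>cx_schouten_eq_0_iff\<close>).

  Poisson Nijenhuis: the defect in the compatibility of the Koszul brackets is tensorial, and its
  value at \<open>u\<close> is \<open>D (J u) \<alpha> \<beta> - D u \<alpha> (J\<^sup>* \<beta>)\<close> (\<open>koszul_concomitant\<close>).

  Generalized complex: the \<open>\<plusminus>i\<close>-eigensections of \<open>K = \<J>\<^sub>\<pi>\<close> are \<open>s \<mp> i K s\<close>, and closure under the
  Courant bracket amounts to the vanishing of the Nijenhuis torsion of \<open>K\<close> with respect to that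
  bracket (\<open>courant_eigen_iff\<close>). The torsion is tensorial too. Its cotangent part is the defect
  of the Cauchy-Riemann condition (\<open>snd_torsion\<close>), and under that condition its tangent part is half
  of \<open>[I, I]\<close> (\<open>fst_torsion\<close>).

  The conditions on the Koszul and Courant brackets are stated for global sections. To obtain pointwise statements
  from them one needs a global one-form with a given value at a given point
  (\<open>one_form_with_value\<close>); by tensoriality nothing more is needed, and it is built with a bump function.
\<close>

section \<open>Calculus of smooth maps\<close>

lemma has_derivative_FD:
  "f differentiable (at x) \<Longrightarrow> (f has_derivative blinfun_apply (FD f x)) (at x)"
  by (simp add: FD_apply frechet_derivative_works[symmetric])

lemma FD_cong:
  assumes "open S" "x \<in> S" "\<And>y. y \<in> S \<Longrightarrow> f y = g y"
  shows "FD f x = FD g x"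
proof -
  have "(f has_derivative D) (at x) \<longleftrightarrow> (g has_derivative D) (at x)" for D
    using has_derivative_transform_within_open[OF _ assms(1,2), of f D UNIV g]
      has_derivative_transform_within_open[OF _ assms(1,2), of g D UNIV f] assms(3)
    by auto
  then show ?thesis
    by (simp add: FD_def frechet_derivative_def)
qed

lemma differentiable_cong:
  assumes "open S" "x \<in> S" "\<And>y. y \<in> S \<Longrightarrow> f y = g y" "f differentiable (at x)"
  shows "g differentiable (at x)"
  using assms(4) has_derivative_transform_within_open[OF _ assms(1,2), of f _ UNIV g] assms(3)
  unfolding differentiable_def by blast

lemma Ck_on_cong_imp:
  assumes "open S" "\<And>y. y \<in> S \<Longrightarrow> f y = g y" "Ck_on k S f"
  shows "Ck_on k S g"
  using assms(2,3)
proof (induction k arbitrary: f g)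
  case 0
  then show ?case by (simp cong: continuous_on_cong)
next
  case (Suc k)
  have "Ck_on k S (\<lambda>x. FD g x v)" for v
    by (rule Suc.IH[of "\<lambda>x. FD f x v"])
      (use Suc.prems FD_cong[OF assms(1) _ Suc.prems(1)] in auto)
  then show ?case
    using Suc.prems differentiable_cong[OF assms(1) _ Suc.prems(1)] by auto
qed

lemma Ck_on_SucI:
  assumes "open S" "\<And>x. x \<in> S \<Longrightarrow> (f has_derivative f' x) (at x)"
    and "\<And>v. Ck_on k S (\<lambda>x. f' x v)"
  shows "Ck_on (Suc k) S f"
proof -
  have "Ck_on k S (\<lambda>x. FD f x v)" for v
    by (rule Ck_on_cong_imp[OF assms(1) _ assms(3)[of v]]) (simp add: FD_eqI[OF assms(2)])
  then show ?thesis
    using assms(2) by (auto simp: differentiable_def)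
qed

lemma Ck_on_SucD: "Ck_on (Suc k) S f \<Longrightarrow> Ck_on k S f"
proof (induction k arbitrary: f)
  case 0
  then show ?case
    by (auto intro!: continuous_at_imp_continuous_on differentiable_imp_continuous_within)
next
  case (Suc k)
  from Suc.prems have "\<forall>x\<in>S. f differentiable (at x)" "\<And>v. Ck_on (Suc k) S (\<lambda>x. FD f x v)"
    by auto
  with Suc.IH show ?case
    by (auto simp del: Ck_on.simps simp: Ck_on.simps(2)[of k])
qed

lemma Ck_on_subset: "Ck_on k S f \<Longrightarrow> T \<subseteq> S \<Longrightarrow> Ck_on k T f"
  by (induction k arbitrary: f) (auto intro: continuous_on_subset)

lemma Ck_on_const: "Ck_on k S (\<lambda>_. c)"
proof (induction k arbitrary: c)
  case (Suc k)
  have "FD (\<lambda>_. c) x v = 0" for x :: 'a and v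
    by (simp add: FD_eqI[OF has_derivative_const])
  with Suc show ?case by simp
qed simp

lemma Ck_on_bounded_linear:
  assumes "open S" "bounded_linear L"
  shows "Ck_on k S f \<Longrightarrow> Ck_on k S (\<lambda>x. L (f x))"
proof (induction k arbitrary: f)
  case 0
  then show ?case by (simp add: bounded_linear.continuous_on[OF assms(2)])
next
  case (Suc k)
  show ?case
    by (rule Ck_on_SucI[OF assms(1), of _ "\<lambda>x v. L (FD f x v)"])
      (use Suc in \<open>auto intro!: bounded_linear.has_derivative[OF assms(2)] has_derivative_FD\<close>)
qed

lemma Ck_on_add:
  assumes "open S"
  shows "Ck_on k S f \<Longrightarrow> Ck_on k S g \<Longrightarrow> Ck_on k S (\<lambda>x. f x + g x)"
proof (induction k arbitrary: f g)
  case 0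
  then show ?case by (simp add: continuous_on_add)
next
  case (Suc k)
  show ?case
    by (rule Ck_on_SucI[OF assms, of _ "\<lambda>x v. FD f x v + FD g x v"])
      (use Suc in \<open>auto intro!: has_derivative_add has_derivative_FD\<close>)
qed

lemma Ck_on_sum:
  assumes "open S" "\<And>i. i \<in> I \<Longrightarrow> Ck_on k S (f i)"
  shows "Ck_on k S (\<lambda>x. \<Sum>i\<in>I. f i x)"
  using assms(2)
  by (induction I rule: infinite_finite_induct) (auto intro: Ck_on_const Ck_on_add[OF assms(1)])

lemma Ck_on_bilinear:
  assumes "open S" "bounded_bilinear B"
  shows "Ck_on k S f \<Longrightarrow> Ck_on k S g \<Longrightarrow> Ck_on k S (\<lambda>x. B (f x) (g x))"
proof (induction k arbitrary: f g)
  case 0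
  then show ?case by (simp add: bounded_bilinear.continuous_on[OF assms(2)])
next
  case (Suc k)
  note Suc.prems[THEN Ck_on_SucD]
  then show ?case
    by (intro Ck_on_SucI[OF assms(1), of _ "\<lambda>x v. B (f x) (FD g x v) + B (FD f x v) (g x)"])
      (use Suc in \<open>auto intro!: Ck_on_add assms(1) bounded_bilinear.FDERIV[OF assms(2)] has_derivative_FD\<close>)
qed

lemma Ck_on_compose:
  fixes f :: "'a::euclidean_space \<Rightarrow> 'b::euclidean_space" and g :: "'b \<Rightarrow> 'c::real_normed_vector"
  assumes "open S" "f ` S \<subseteq> T"
  shows "Ck_on k S f \<Longrightarrow> Ck_on k T g \<Longrightarrow> Ck_on k S (\<lambda>x. g (f x))"
proof (induction k arbitrary: g)
  case 0
  then show ?case using assms(2) by (auto intro: continuous_on_compose2)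
next
  case (Suc k)
  show ?case
  proof (rule Ck_on_SucI[OF assms(1), of _ "\<lambda>x v. FD g (f x) (FD f x v)"])
    fix x assume "x \<in> S"
    then show "((\<lambda>x. g (f x)) has_derivative (\<lambda>v. FD g (f x) (FD f x v))) (at x)"
      using Suc.prems assms(2)
      by (auto intro!: has_derivative_compose[where g=g] has_derivative_FD)
  next
    fix v
    have *: "FD g (f x) (FD f x v) = (\<Sum>e\<in>Basis. (FD f x v \<bullet> e) *\<^sub>R FD g (f x) e)" for x
      by (subst euclidean_representation[symmetric, of "FD f x v"])
        (simp only: blinfun.bilinear_simps blinfun.sum_right)
    show "Ck_on k S (\<lambda>x. FD g (f x) (FD f x v))"
      unfolding *
      by (intro Ck_on_sum assms(1) Ck_on_bilinear[OF _ bounded_bilinear_scaleR]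
          Ck_on_bounded_linear[OF _ bounded_linear_inner_left] Suc.IH)
        (use Suc.prems Ck_on_SucD[OF Suc.prems(1)] in auto)
  qed
qed

text \<open>
  Differentiability at a point is a local property, so smoothness can be glued over two open sets. This
  is how a form that is cut off inside a chart is seen to be smooth in every other chart.
\<close>

lemma Ck_on_Un:
  assumes "open S" "open T" "Ck_on k S f" "Ck_on k T f"
  shows "Ck_on k (S \<union> T) f"
  using assms(3,4)
  by (induction k arbitrary: f) (auto intro: continuous_on_open_Un assms)

lemma smooth_on_cong:
  "open S \<Longrightarrow> smooth_on S f \<Longrightarrow> (\<And>y. y \<in> S \<Longrightarrow> f y = g y) \<Longrightarrow> smooth_on S g"
  unfolding smooth_on_def by (metis Ck_on_cong_imp)

lemma smooth_on_const: "smooth_on S (\<lambda>_. c)"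
  unfolding smooth_on_def by (metis Ck_on_const)

lemma smooth_on_bounded_linear:
  "open S \<Longrightarrow> bounded_linear L \<Longrightarrow> smooth_on S f \<Longrightarrow> smooth_on S (\<lambda>x. L (f x))"
  unfolding smooth_on_def by (metis Ck_on_bounded_linear)

lemma smooth_on_add: "open S \<Longrightarrow> smooth_on S f \<Longrightarrow> smooth_on S g \<Longrightarrow> smooth_on S (\<lambda>x. f x + g x)"
  unfolding smooth_on_def by (metis Ck_on_add)

lemma smooth_on_sum:
  "open S \<Longrightarrow> (\<And>i. i \<in> I \<Longrightarrow> smooth_on S (f i)) \<Longrightarrow> smooth_on S (\<lambda>x. \<Sum>i\<in>I. f i x)"
  unfolding smooth_on_def by (metis Ck_on_sum)

lemma smooth_on_bilinear:
  "open S \<Longrightarrow> bounded_bilinear B \<Longrightarrow> smooth_on S f \<Longrightarrow> smooth_on S g \<Longrightarrow> smooth_on S (\<lambda>x. B (f x) (g x))"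
  unfolding smooth_on_def by (metis Ck_on_bilinear)

lemma smooth_on_compose:
  "open S \<Longrightarrow> f ` S \<subseteq> T \<Longrightarrow> smooth_on S f \<Longrightarrow> smooth_on T g \<Longrightarrow> smooth_on S (\<lambda>x. g (f x))"
  for f :: "'a::euclidean_space \<Rightarrow> 'b::euclidean_space"
  unfolding smooth_on_def by (metis Ck_on_compose)

lemma smooth_on_Un: "open S \<Longrightarrow> open T \<Longrightarrow> smooth_on S f \<Longrightarrow> smooth_on T f \<Longrightarrow> smooth_on (S \<union> T) f"
  unfolding smooth_on_def by (metis Ck_on_Un)

lemma smooth_on_FD: "smooth_on S f \<Longrightarrow> smooth_on S (\<lambda>x. FD f x v)"
  unfolding smooth_on_def by (metis Ck_on.simps(2))

lemma smooth_on_imp_differentiable: "smooth_on S f \<Longrightarrow> x \<in> S \<Longrightarrow> f differentiable (at x)"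
  unfolding smooth_on_def by (metis Ck_on.simps(2))

lemma smooth_on_id: "smooth_on S (\<lambda>x::'a::euclidean_space. x)"
proof -
  have "Ck_on k UNIV (\<lambda>x::'a. x)" for k
    by (rule Ck_on_SucD, rule Ck_on_SucI[of _ _ "\<lambda>_ v. v"]) (auto intro: Ck_on_const)
  then show ?thesis
    unfolding smooth_on_def by (metis Ck_on_subset subset_UNIV)
qed

section \<open>Smooth bump functions\<close>

text \<open>
  The function \<open>t\<^sup>-\<^sup>n exp(-1/t)\<close>, extended by zero. The family over all \<open>n\<close> is considered at once because
  the derivative of a member is a linear combination of members (\<open>flat_has_derivative\<close>), which makes
  smoothness an induction without any polynomials in \<open>1/t\<close>.
\<close>

definition flat :: "nat \<Rightarrow> real \<Rightarrow> real" where
  "flat n t = (if t > 0 then exp (- (1 / t)) / t ^ n else 0)"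

text \<open>
  A single term of the series of \<open>exp (1 / t)\<close> gives the bound. Being quadratic, it makes the derivative
  at 0 vanish.
\<close>

lemma flat_bound: "\<bar>flat n t\<bar> \<le> fact (n + 2) * t\<^sup>2"
proof (cases "t > 0")
  case True
  have "(\<Sum>k\<in>{n+2}. (1/t) ^ k /\<^sub>R fact k) \<le> (\<Sum>k. (1/t) ^ k /\<^sub>R fact k)"
    by (rule sum_le_suminf[OF summable_exp_generic]) (use True in auto)
  also have "\<dots> = exp (1 / t)"
    by (simp only: exp_def)
  finally have "1 / (t ^ (n + 2) * fact (n + 2)) \<le> exp (1 / t)"
    by (simp only: sum.insert[OF finite.emptyI] sum.empty power_divide empty_iff not_False_eq_True)
      (simp add: divide_inverse mult_ac)
  then have "exp (- (1 / t)) \<le> t ^ (n + 2) * fact (n + 2)"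
    using True by (simp only: exp_minus inverse_eq_divide)
      (simp add: pos_divide_le_eq mult.commute del: fact_Suc power_Suc add_2_eq_Suc')
  then have "exp (- (1 / t)) / t ^ n \<le> fact (n + 2) * t\<^sup>2"
    using True by (simp add: pos_divide_le_eq power2_eq_square mult_ac)
  then show ?thesis
    using True by (simp add: flat_def)
qed (simp add: flat_def)

lemma flat_has_derivative:
  "(flat n has_real_derivative flat (n + 2) t - real n * flat (n + 1) t) (at t)"
proof -
  consider "t > 0" | "t < 0" | "t = 0" by linarith
  then show ?thesis
  proof cases
    case 1
    have "((\<lambda>t. exp (- (1 / t)) / t ^ n) has_real_derivative
        flat (n + 2) t - real n * flat (n + 1) t) (at t)"
    proof -
      have pow: "((\<lambda>t. t ^ n) has_real_derivative real n * t ^ n / t) (at t)"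
        using 1 DERIV_pow[of n t] by (cases n) auto
      have exp: "((\<lambda>t. exp (- (1 / t))) has_real_derivative exp (- (1 / t)) / t\<^sup>2) (at t)"
        using 1 by (auto intro!: derivative_eq_intros simp: power2_eq_square)
      show ?thesis
        by (rule DERIV_cong[OF DERIV_quotient[OF exp pow]])
          (use 1 in \<open>auto simp: flat_def field_simps power2_eq_square power_add\<close>)
    qed
    then show ?thesis
      by (rule has_field_derivative_transform_within_open[where S="{0<..}"]) (use 1 in \<open>auto simp: flat_def\<close>)
  next
    case 2
    have "((\<lambda>t. 0) has_real_derivative flat (n + 2) t - real n * flat (n + 1) t) (at t)"
      using 2 by (simp add: flat_def)
    then show ?thesis
      by (rule has_field_derivative_transform_within_open[where S="{..<0}"]) (use 2 in \<open>auto simp: flat_def\<close>)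
  next
    case 3
    have "((\<lambda>h. (flat n (0 + h) - flat n 0) / h) \<longlongrightarrow> 0) (at 0)"
    proof (rule Lim_null_comparison)
      show "\<forall>\<^sub>F h in at 0. norm ((flat n (0 + h) - flat n 0) / h) \<le> fact (n + 2) * \<bar>h\<bar>"
      proof (rule eventuallyI)
        fix h :: real
        show "norm ((flat n (0 + h) - flat n 0) / h) \<le> fact (n + 2) * \<bar>h\<bar>"
          using flat_bound[of n h]
          by (cases "h = 0") (simp_all add: flat_def[of n 0] pos_divide_le_eq mult.assoc
              power2_eq_square del: fact_Suc)
      qed
      show "((\<lambda>h. fact (n + 2) * \<bar>h\<bar>) \<longlongrightarrow> 0) (at (0::real))"
        by (rule tendsto_eq_intros refl)+ simp
    qed
    then show ?thesis
      using 3 by (simp add: DERIV_def flat_def[of _ 0])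
  qed
qed

lemma Ck_on_flat: "Ck_on k UNIV (flat n)"
proof (induction k arbitrary: n)
  case 0
  show ?case
    using flat_has_derivative by (auto intro!: DERIV_continuous_on[of UNIV "flat n"])
next
  case (Suc k)
  have "Ck_on k UNIV (\<lambda>t. v * flat (n + 2) t + (- v * real n) * flat (n + 1) t)" for v
    by (intro Ck_on_add Ck_on_bounded_linear[OF open_UNIV bounded_linear_mult_right] Suc) simp
  then have "Ck_on k UNIV (\<lambda>t. (flat (n + 2) t - real n * flat (n + 1) t) * v)" for v
    by (simp add: algebra_simps)
  then show ?case
    by (rule Ck_on_SucI[OF open_UNIV flat_has_derivative[unfolded has_field_derivative_def]])
qed

text \<open>
  As \<open>flat 0\<close> vanishes on the negative numbers, composing it with \<open>r\<^sup>2 - \<bar>y - p\<bar>\<^sup>2\<close> confines the support to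
  the ball.
\<close>

lemma smooth_bump:
  fixes p :: "'e::euclidean_space"
  assumes "r > 0"
  obtains \<rho> :: "'e \<Rightarrow> real" where "smooth_on UNIV \<rho>" "\<rho> p = 1" "\<And>y. y \<notin> cball p r \<Longrightarrow> \<rho> y = 0"
proof
  let ?q = "\<lambda>y. r\<^sup>2 + - ((y + - p) \<bullet> (y + - p))"
  let ?\<rho> = "\<lambda>y. inverse (flat 0 (r\<^sup>2)) * flat 0 (?q y)"
  have flat: "smooth_on UNIV (flat 0)"
    by (simp add: smooth_on_def Ck_on_flat)
  have d: "smooth_on UNIV (\<lambda>y. y + - p)"
    by (intro smooth_on_add smooth_on_const smooth_on_id open_UNIV)
  have "smooth_on UNIV ?q"
    by (intro smooth_on_add open_UNIV smooth_on_const
        smooth_on_bounded_linear[OF open_UNIV bounded_linear_minus[OF bounded_linear_ident]]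
        smooth_on_bilinear[OF open_UNIV bounded_bilinear_inner] d)
  then show "smooth_on UNIV ?\<rho>"
    by (intro smooth_on_bounded_linear[OF open_UNIV bounded_linear_mult_right]
        smooth_on_compose[OF open_UNIV subset_UNIV _ flat])
  show "?\<rho> p = 1"
    using assms by (simp add: flat_def)
  show "?\<rho> y = 0" if "y \<notin> cball p r" for y
  proof -
    from that have "r < norm (y - p)"
      by (simp add: dist_norm norm_minus_commute)
    then have "r\<^sup>2 < (norm (y - p))\<^sup>2"
      using assms by (intro power_strict_mono) auto
    then show ?thesis
      by (simp add: flat_def power2_norm_eq_inner)
  qed
qed

section \<open>Charts of a complex manifold\<close>

lemma complex_manifoldD:
  assumes "complex_manifold A" "c \<in> A"
  shows "open (fst c)" "open (chart_image c)" "inj_on (snd c) (fst c)"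
    and "continuous_on (chart_image c) (inv_into (fst c) (snd c))"
    and "U \<subseteq> fst c \<Longrightarrow> open U \<Longrightarrow> open (snd c ` U)"
proof -
  obtain g where g: "homeomorphism (fst c) (chart_image c) (snd c) g"
    using assms unfolding complex_manifold_def by blast
  show "open (fst c)" and op: "open (chart_image c)"
    using assms unfolding complex_manifold_def by blast+
  show inj: "inj_on (snd c) (fst c)"
    using g unfolding homeomorphism_def by (metis inj_onI)
  have "g x = inv_into (fst c) (snd c) x" if "x \<in> chart_image c" for x
    using g that inj unfolding homeomorphism_def chart_image_def
    by (metis inv_into_f_f image_eqI imageE)
  then show "continuous_on (chart_image c) (inv_into (fst c) (snd c))"
    using g unfolding homeomorphism_def by (metis continuous_on_cong)
  show "open (snd c ` U)" if "U \<subseteq> fst c" "open U"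
  proof -
    have "openin (top_of_set (chart_image c)) (snd c ` U)"
      using homeomorphism_imp_open_map[OF g] that by (simp add: open_subset)
    with op show ?thesis
      using openin_open_trans by blast
  qed
qed

lemma transition_chart:
  assumes "complex_manifold A" "c \<in> A" "p \<in> fst c"
  shows "transition c d (snd c p) = snd d p"
  using complex_manifoldD(3)[OF assms(1,2)] assms(3) by (simp add: transition_def inv_into_f_f)

lemma open_overlap: "complex_manifold A \<Longrightarrow> c \<in> A \<Longrightarrow> d \<in> A \<Longrightarrow> open (overlap c d)"
  unfolding overlap_def by (rule complex_manifoldD(5)) (auto simp: complex_manifoldD(1))

lemma complex_manifold_smooth_transition:
  "complex_manifold A \<Longrightarrow> c \<in> A \<Longrightarrow> d \<in> A \<Longrightarrow> smooth_on (overlap c d) (transition c d)"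
  by (simp add: complex_manifold_def)

lemma jac_J0:
  assumes "complex_manifold A" "c \<in> A" "d \<in> A" "x \<in> overlap c d"
  shows "jac c d x (J0 v) = J0 (jac c d x v)"
proof -
  have "jac c d x o\<^sub>L J0 = J0 o\<^sub>L jac c d x"
    using assms unfolding complex_manifold_def by blast
  then show ?thesis
    by (metis blinfun_apply_blinfun_compose)
qed

text \<open>
  The chain rule for the transition maps, applied on the image of the triple intersection.
\<close>

lemma jac_cocycle:
  assumes "complex_manifold A" "c \<in> A" "d \<in> A" "e \<in> A" "p \<in> fst c" "p \<in> fst d" "p \<in> fst e"
  shows "jac d e (snd d p) o\<^sub>L jac c d (snd c p) = jac c e (snd c p)"
proof (rule blinfun_eqI)
  fix v
  let ?U = "fst c \<inter> fst d \<inter> fst e"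
  note m = assms(1) and opn = complex_manifoldD(1)[OF assms(1)]
  have "open (snd c ` ?U)"
    by (rule complex_manifoldD(5)[OF m \<open>c \<in> A\<close>]) (use assms in \<open>simp_all add: open_Int opn le_infI1\<close>)
  moreover have "snd c p \<in> snd c ` ?U"
    using assms by auto
  moreover have "transition c e y = transition d e (transition c d y)" if "y \<in> snd c ` ?U" for y
    using that by (auto simp: transition_chart[OF m] assms)
  ultimately have "jac c e (snd c p) = FD (\<lambda>y. transition d e (transition c d y)) (snd c p)"
    unfolding jac_def by (rule FD_cong)
  moreover have "(transition c d has_derivative jac c d (snd c p)) (at (snd c p))"
    unfolding jac_def using assms
    by (intro has_derivative_FD smooth_on_imp_differentiable[OF complex_manifold_smooth_transition])
      (auto simp: overlap_def)
  moreover have "(transition d e has_derivative jac d e (snd d p)) (at (transition c d (snd c p)))"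
    unfolding jac_def transition_chart[OF m \<open>c \<in> A\<close> \<open>p \<in> fst c\<close>] using assms
    by (intro has_derivative_FD smooth_on_imp_differentiable[OF complex_manifold_smooth_transition])
      (auto simp: overlap_def)
  ultimately show "(jac d e (snd d p) o\<^sub>L jac c d (snd c p)) v = jac c e (snd c p) v"
    by (simp add: FD_eqI[OF has_derivative_compose])
qed

lemma jac_self:
  assumes "complex_manifold A" "c \<in> A" "p \<in> fst c"
  shows "jac c c (snd c p) = id_blinfun"
proof (rule blinfun_eqI)
  fix v
  have "jac c c (snd c p) = FD (\<lambda>y. y) (snd c p)"
    unfolding jac_def
    by (rule FD_cong[OF complex_manifoldD(2)[OF assms(1,2)]])
      (use assms in \<open>auto simp: chart_image_def transition_chart\<close>)
  then show "jac c c (snd c p) v = id_blinfun v"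
    by (simp add: FD_eqI[OF has_derivative_ident])
qed

lemma jac_inverse:
  assumes "complex_manifold A" "c \<in> A" "d \<in> A" "x \<in> overlap c d"
  shows "jac d c (transition c d x) (jac c d x v) = v"
    and "jac c d x (jac d c (transition c d x) w) = w"
proof -
  obtain p where p: "p \<in> fst c" "p \<in> fst d" "x = snd c p"
    using assms(4) by (auto simp: overlap_def)
  have "jac d c (snd d p) o\<^sub>L jac c d (snd c p) = id_blinfun"
    "jac c d (snd c p) o\<^sub>L jac d c (snd d p) = id_blinfun"
    using p assms by (simp_all add: jac_cocycle[OF assms(1)] jac_self[OF assms(1)])
  then show "jac d c (transition c d x) (jac c d x v) = v"
    "jac c d x (jac d c (transition c d x) w) = w"
    unfolding p(3) transition_chart[OF assms(1,2) p(1)]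
    by (metis blinfun_apply_blinfun_compose blinfun_apply_id_blinfun id_apply)+
qed

section \<open>Global one-forms with a prescribed value\<close>

lemma covector_expand: "(a::'e::euclidean_space covector) = (\<Sum>e\<in>Basis. a e *\<^sub>R blinfun_inner_left e)"
  by (rule blinfun_euclidean_eqI)
    (simp add: blinfun.bilinear_simps blinfun.sum_left inner_Basis if_distrib cong: if_cong)

text \<open>
  The form is \<open>\<rho> a\<close> in the chart \<open>c\<close>, for a bump function \<open>\<rho>\<close> supported in a closed ball inside the
  chart image, and zero outside the domain of \<open>c\<close>. The part \<open>K\<close> of the manifold that corresponds to the
  ball is compact, hence closed in the Hausdorff space. So any other chart image is the union
  of two open sets: the overlap with \<open>c\<close>, where the form is the pullback of \<open>\<rho> a\<close>, and the complement of
  \<open>K\<close>, where it vanishes.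
\<close>

lemma one_form_with_value:
  fixes A :: "('a::{t2_space, second_countable_topology}, 'n::finite) chart set"
    and a :: "(complex ^ 'n) covector"
  assumes m: "complex_manifold A" and c: "c \<in> A" and x: "x \<in> chart_image c"
  obtains \<alpha> where "one_form A \<alpha>" "\<alpha> c x = a"
proof -
  obtain r where r: "r > 0" "cball x r \<subseteq> chart_image c"
    using complex_manifoldD(2)[OF m c] x open_contains_cball by metis
  obtain \<rho> :: "complex ^ 'n \<Rightarrow> real"
    where \<rho>: "smooth_on UNIV \<rho>" "\<rho> x = 1" "\<And>y. y \<notin> cball x r \<Longrightarrow> \<rho> y = 0"
    using smooth_bump[OF r(1)] by metis
  define K where "K = inv_into (fst c) (snd c) ` cball x r"
  have "compact K"
    unfolding K_def
    by (intro compact_continuous_image compact_cball continuous_on_subset[OF complex_manifoldD(4)[OF m c] r(2)])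
  then have "closed K"
    by (rule compact_imp_closed)
  \<comment> \<open>The pullback of the cut-off form along the transition to c.\<close>
  define \<alpha> :: "('a, 'n) chart \<Rightarrow> complex ^ 'n \<Rightarrow> (complex ^ 'n) covector" where
    "\<alpha> d y = (if y \<in> overlap d c then \<rho> (transition d c y) *\<^sub>R (a o\<^sub>L jac d c y) else 0)" for d y
  have smooth: "smooth_on (chart_image d) (\<alpha> d)" if d: "d \<in> A" for d
  proof -
    let ?S = "overlap d c" and ?T = "snd d ` (fst d - K)"
    have oS: "open ?S" and oT: "open ?T"
      using open_overlap[OF m d c] complex_manifoldD(1)[OF m d] \<open>closed K\<close>
      by (auto intro: complex_manifoldD(5)[OF m d])
    have "K \<subseteq> fst c"
      using r(2) by (auto simp: K_def chart_image_def intro: inv_into_into)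
    then have un: "chart_image d = ?S \<union> ?T"
      by (auto simp: overlap_def chart_image_def)
    have "smooth_on ?S (\<lambda>y. \<rho> (transition d c y) *\<^sub>R
        (\<Sum>e\<in>Basis. a (FD (transition d c) y e) *\<^sub>R blinfun_inner_left e))"
      by (intro smooth_on_bilinear[OF oS bounded_bilinear_scaleR]
          smooth_on_compose[OF oS subset_UNIV _ \<rho>(1)] smooth_on_sum oS smooth_on_const
          smooth_on_bounded_linear[OF oS blinfun.bounded_linear_right] smooth_on_FD
          complex_manifold_smooth_transition[OF m d c])
    then have 1: "smooth_on ?S (\<alpha> d)"
    proof (rule smooth_on_cong[OF oS])
      fix y assume "y \<in> ?S"
      then show "\<rho> (transition d c y) *\<^sub>R (\<Sum>e\<in>Basis. a (FD (transition d c) y e) *\<^sub>R blinfun_inner_left e)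
          = \<alpha> d y"
        using covector_expand[of "a o\<^sub>L jac d c y"] by (simp add: \<alpha>_def jac_def)
    qed
    have 2: "smooth_on ?T (\<alpha> d)"
    proof (rule smooth_on_cong[OF oT smooth_on_const[of _ 0]])
      fix y assume "y \<in> ?T"
      then obtain p where p: "p \<in> fst d" "p \<notin> K" "y = snd d p"
        by blast
      have "\<rho> (snd c p) = 0" if "p \<in> fst c"
      proof (rule \<rho>(3))
        show "snd c p \<notin> cball x r"
          using p(2) that complex_manifoldD(3)[OF m c] unfolding K_def
          by (metis imageI inv_into_f_f)
      qed
      moreover have "p \<in> fst c" if "y \<in> overlap d c"
        using that p complex_manifoldD(3)[OF m d] by (auto simp: overlap_def dest: inj_onD)
      ultimately show "0 = \<alpha> d y"
        using p by (auto simp: \<alpha>_def transition_chart[OF m d])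
    qed
    show ?thesis
      unfolding un by (rule smooth_on_Un[OF oS oT 1 2])
  qed
  have "\<alpha> d y = \<alpha> e (transition d e y) o\<^sub>L jac d e y"
    if d: "d \<in> A" and e: "e \<in> A" and y: "y \<in> overlap d e" for d e y
  proof -
    obtain p where p: "p \<in> fst d" "p \<in> fst e" "y = snd d p"
      using y by (auto simp: overlap_def)
    have iff: "snd f p \<in> overlap f c \<longleftrightarrow> p \<in> fst c" if "f \<in> A" "p \<in> fst f" for f
      using that complex_manifoldD(3)[OF m that(1)] by (auto simp: overlap_def dest: inj_onD)
    show ?thesis
    proof (cases "p \<in> fst c")
      case True
      have "jac d c (snd d p) v = jac e c (snd e p) (jac d e (snd d p) v)" for v
        by (simp add: jac_cocycle[OF m d e c p(1,2) True, symmetric])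
      then show ?thesis
        using True p d e
        by (auto simp: \<alpha>_def iff transition_chart[OF m] intro!: blinfun_eqI simp: blinfun.bilinear_simps)
    next
      case False
      then show ?thesis
        using p d e by (auto simp: \<alpha>_def iff transition_chart[OF m] intro!: blinfun_eqI)
    qed
  qed
  with smooth have "one_form A \<alpha>"
    unfolding one_form_def by blast
  moreover have "\<alpha> c x = a"
  proof -
    obtain p where "p \<in> fst c" "x = snd c p"
      using x by (auto simp: chart_image_def)
    then show ?thesis
      using \<rho>(2) by (auto simp: \<alpha>_def overlap_def transition_chart[OF m c] jac_self[OF m c]
          intro!: blinfun_eqI)
  qed
  ultimately show ?thesis
    by (rule that)
qed

section \<open>Bivectors and their sharp maps\<close>

lemma sharp_eq_sum:
  "sharp P a = (\<Sum>e\<in>Basis. P a (blinfun_inner_left e) *\<^sub>R e)" for P :: "'e::euclidean_space bivector"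
proof -
  have "sharp P a \<bullet> e = P a (blinfun_inner_left e)" for e
    using sharp_apply[of "blinfun_inner_left e" P a] by (simp add: inner_commute)
  then show ?thesis
    by (metis (no_types, lifting) euclidean_representation sum.cong)
qed

lemma bounded_bilinear_sharp: "bounded_bilinear (sharp :: 'e::euclidean_space bivector \<Rightarrow> _)"
proof
  show "\<exists>K. \<forall>P a. norm (sharp P a :: 'e) \<le> norm P * norm a * K"
  proof (intro exI allI)
    fix P :: "'e bivector" and a
    have "norm (P a (blinfun_inner_left e) *\<^sub>R e) \<le> norm P * norm a * norm (blinfun_inner_left e)"
      if "e \<in> Basis" for e
    proof -
      have "norm (P a (blinfun_inner_left e)) \<le> norm (P a) * norm (blinfun_inner_left e)"
        by (rule norm_blinfun)
      also have "\<dots> \<le> norm P * norm a * norm (blinfun_inner_left e)"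
        by (intro mult_right_mono norm_blinfun) simp
      finally show ?thesis using that by simp
    qed
    then show "norm (sharp P a) \<le> norm P * norm a * (\<Sum>e\<in>Basis. norm (blinfun_inner_left e :: 'e covector))"
      unfolding sharp_eq_sum sum_distrib_left by (rule sum_norm_le)
  qed
qed (rule covectors_separate; simp add: sharp_apply blinfun.bilinear_simps)+

lemma alternating_skew:
  fixes P :: "'e::euclidean_space bivector"
  assumes "\<And>a. P a a = 0"
  shows "P a b = - P b a"
  using assms[of "a + b"] assms[of a] assms[of b] by (simp add: blinfun.bilinear_simps)

lemma bivector_expand:
  fixes P :: "'e::euclidean_space bivector" and a b :: "'e covector"
  shows "(\<Sum>e\<in>Basis. \<Sum>f\<in>Basis. P (blinfun_inner_left e) (blinfun_inner_left f) * (a e * b f)) = P a b"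
proof -
  have "P a b = P (\<Sum>e\<in>Basis. a e *\<^sub>R blinfun_inner_left e) (\<Sum>f\<in>Basis. b f *\<^sub>R blinfun_inner_left f)"
    by (simp only: covector_expand[symmetric])
  then show ?thesis
    by (subst sum.swap) (simp only: blinfun.sum_left blinfun.sum_right blinfun.bilinear_simps real_scaleR_def
        sum_distrib_left mult_ac)
qed

section \<open>Bivectors of type (2,0)\<close>

lemma compose_J_J:
  fixes J :: "'e::euclidean_space \<Rightarrow>\<^sub>L 'e" and a :: "'e covector"
  assumes "\<And>v. J (J v) = - v"
  shows "a o\<^sub>L J o\<^sub>L J = - a"
  by (rule blinfun_eqI) (simp add: assms blinfun.bilinear_simps)

lemma covector_J_sharp:
  fixes J :: "'e::euclidean_space \<Rightarrow>\<^sub>L 'e" and b :: "'e covector"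
  shows "b (J (sharp P a)) = P a (b o\<^sub>L J)"
  using sharp_apply[of "b o\<^sub>L J" P a] by simp

text \<open>
  Skewness of both bivectors moves \<open>J\<close> from one argument to the other.
\<close>

lemma type20_commutes:
  fixes R I :: "'e::euclidean_space bivector" and J :: "'e \<Rightarrow>\<^sub>L 'e"
  assumes "\<And>a. R a a = 0" "\<And>a. I a a = 0" "\<And>a b. R a b = I (a o\<^sub>L J) b"
  shows "I (a o\<^sub>L J) b = I a (b o\<^sub>L J)"
  using alternating_skew[of R, OF assms(1), of a b] alternating_skew[of I, OF assms(2), of "b o\<^sub>L J" a]
  by (simp add: assms(3))

text \<open>
  An element of \<open>T\<^sup>1\<^sup>,\<^sup>0\<close> has the form \<open>v - i J v\<close>. For the generators the relation is a direct
  computation, and it is linear. Conversely, replacing \<open>e \<and> f\<close> by \<open>(e - i J e) \<and> (f - i J f)\<close> in the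
  expansion of \<open>R\<close> in a basis maps \<open>R\<close> into \<open>\<Lambda>\<^sup>2T\<^sup>1\<^sup>,\<^sup>0\<close>; if the relation holds, its image
  is, up to a constant, \<open>R + i I\<close>.
\<close>

lemma wedge2_T10_iff:
  fixes R I :: "(complex ^ 'n::finite) bivector" and J :: "(complex ^ 'n) \<Rightarrow>\<^sub>L (complex ^ 'n)"
  assumes J: "\<And>v. J (J v) = - v" and R: "\<And>a. R a a = 0" and I: "\<And>a. I a a = 0"
  shows "(R, I) \<in> wedge2_T10 J \<longleftrightarrow> (\<forall>a b. R a b = I (a o\<^sub>L J) b)"
proof
  define T where "T = {Z :: (complex ^ 'n) bivector cx. \<forall>a b.
    blinfun_apply (blinfun_apply (fst Z) a) b = blinfun_apply (blinfun_apply (snd Z) (a o\<^sub>L J)) b}"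
  have sub: "subspace T"
    by (auto simp: T_def subspace_def blinfun.bilinear_simps)
  have "cx_bilin wedge Z W \<in> T" if "Z \<in> T10 J" "W \<in> T10 J" for Z W
  proof -
    have "snd Z = - J (fst Z)" "snd W = - J (fst W)"
      using that by (auto simp: T10_def cx_map_def cx_scale_def prod_eq_iff)
    then show ?thesis
      by (simp add: T_def cx_bilin_def wedge_apply blinfun.bilinear_simps J algebra_simps)
  qed
  moreover assume "(R, I) \<in> wedge2_T10 J"
  ultimately have "(R, I) \<in> T"
    unfolding wedge2_T10_def by (elim span_minimal[OF _ sub, THEN subsetD, rotated]) auto
  then show "\<forall>a b. R a b = I (a o\<^sub>L J) b"
    by (simp add: T_def)
next
  assume RI: "\<forall>a b. R a b = I (a o\<^sub>L J) b"
  have IJ: "I (a o\<^sub>L J) b = I a (b o\<^sub>L J)" for a b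
    by (rule type20_commutes[of R]) (use R I RI in auto)
  let ?B = "Basis :: (complex ^ 'n) set"
  let ?d = "blinfun_inner_left :: complex ^ 'n \<Rightarrow> (complex ^ 'n) covector"
  let ?T = "\<Sum>e\<in>?B. \<Sum>f\<in>?B. (R (?d e) (?d f) / 4) *\<^sub>R cx_bilin wedge (e, - J e) (f, - J f)"
  \<comment> \<open>The expansion of R, kept folded so that it can be recognized in the sums below.\<close>
  define S where "S a b = (\<Sum>e\<in>?B. \<Sum>f\<in>?B. R (?d e) (?d f) * (a e * b f))" for a b :: "(complex ^ 'n) covector"
  have S: "S a b = R a b" for a b
    unfolding S_def by (rule bivector_expand)
  have T10: "(v, - J v) \<in> T10 J" for v
    by (simp add: T10_def cx_map_def cx_scale_def J blinfun.bilinear_simps)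
  have "cx_bilin wedge (v, - J v) (w, - J w) \<in> wedge2_T10 J" for v w
    unfolding wedge2_T10_def by (rule span_base) (use T10 in blast)
  then have T_in: "?T \<in> wedge2_T10 J"
    unfolding wedge2_T10_def by (intro span_sum span_scale)
  moreover have "fst ?T = R"
  proof (intro blinfun_eqI)
    fix a b
    have "blinfun_apply (blinfun_apply (fst ?T) a) b = (\<Sum>e\<in>?B. \<Sum>f\<in>?B. R (?d e) (?d f) / 4 *
        ((a e * b f - a f * b e) - ((a o\<^sub>L J) e * (b o\<^sub>L J) f - (a o\<^sub>L J) f * (b o\<^sub>L J) e)))"
      by (simp add: fst_sum blinfun.sum_left cx_bilin_def wedge_apply blinfun.bilinear_simps)
    also have "\<dots> = (S a b - S b a - S (a o\<^sub>L J) (b o\<^sub>L J) + S (b o\<^sub>L J) (a o\<^sub>L J)) / 4"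
      by (simp only: S_def sum_divide_distrib sum_subtractf[symmetric]
          sum.distrib[symmetric])
        (simp add: algebra_simps add_divide_distrib diff_divide_distrib)
    also have "\<dots> = R a b"
      using alternating_skew[OF R, of b a] alternating_skew[OF R, of "b o\<^sub>L J" "a o\<^sub>L J"]
      by (simp add: S RI IJ compose_J_J J blinfun.bilinear_simps)
    finally show "blinfun_apply (blinfun_apply (fst ?T) a) b = R a b" .
  qed
  moreover have "snd ?T = I"
  proof (intro blinfun_eqI)
    fix a b
    have "blinfun_apply (blinfun_apply (snd ?T) a) b = (\<Sum>e\<in>?B. \<Sum>f\<in>?B. R (?d e) (?d f) / 4 *
        (- (a e * (b o\<^sub>L J) f - (a o\<^sub>L J) f * b e) - ((a o\<^sub>L J) e * b f - a f * (b o\<^sub>L J) e)))"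
      by (simp add: snd_sum blinfun.sum_left cx_bilin_def wedge_apply blinfun.bilinear_simps algebra_simps)
    also have "\<dots> = (S b (a o\<^sub>L J) + S (b o\<^sub>L J) a - S a (b o\<^sub>L J) - S (a o\<^sub>L J) b) / 4"
      by (simp only: S_def sum_divide_distrib sum_subtractf[symmetric]
          sum.distrib[symmetric])
        (simp add: algebra_simps add_divide_distrib diff_divide_distrib)
    also have "\<dots> = I a b"
      using alternating_skew[OF I, of b a]
      by (simp add: S RI IJ compose_J_J J blinfun.bilinear_simps)
    finally show "blinfun_apply (blinfun_apply (snd ?T) a) b = I a b" .
  qed
  ultimately have "?T = (R, I)"
    by (intro prod_eqI) (simp_all only: fst_conv snd_conv)
  with T_in show "(R, I) \<in> wedge2_T10 J"
    by (simp only:)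
qed

lemma J0_J0: "J0 (J0 v) = - v"
  by (simp add: J0_apply vec_eq_iff)

lemma dy_eq: "blinfun_inner_left (axis j \<i>) = - (blinfun_inner_left (axis j 1) o\<^sub>L J0)"
  by (rule blinfun_eqI)
    (simp add: inner_axis J0_apply inner_complex_def blinfun.bilinear_simps)

lemmas blinfun_compose_minus = bounded_bilinear.minus_left[OF bounded_bilinear_blinfun_compose]
  bounded_bilinear.minus_right[OF bounded_bilinear_blinfun_compose]

text \<open>
  Since \<open>dy\<^sub>j = - J\<^sup>* dx\<^sub>j\<close>, moving \<open>J\<^sup>*\<close> between the arguments, and between \<open>R\<close> and \<open>I\<close>, turns every
  value of \<open>R\<close> or \<open>I\<close> on these covectors into one on \<open>dx\<^sub>j\<close> and \<open>dx\<^sub>k\<close>.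
\<close>

lemma holo_coeff_eq:
  fixes R I :: "(complex ^ 'n::finite) bivector"
  assumes "\<And>a b. R a b = I (a o\<^sub>L J0) b" "\<And>a b. I (a o\<^sub>L J0) b = I a (b o\<^sub>L J0)"
  shows "holo_coeff (R, I) j k = 4 * (of_real (R (blinfun_inner_left (axis j 1)) (blinfun_inner_left (axis k 1)))
    + \<i> * of_real (I (blinfun_inner_left (axis j 1)) (blinfun_inner_left (axis k 1))))"
  by (simp add: holo_coeff_def dz_def cx_bilin_def cx_number_def dy_eq assms compose_J_J[OF J0_J0] blinfun_compose_minus
      blinfun.bilinear_simps complex_eq_iff)

section \<open>The Cauchy-Riemann condition at a point\<close>

text \<open>
  A bivector field \<open>R + i I\<close> of type (2,0) near a point of a vector space with constant complex structure.
  Everything in the three conditions that depends on derivatives is decided at such a point.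
\<close>

locale type20_germ =
  fixes J :: "'e::euclidean_space \<Rightarrow>\<^sub>L 'e" and S :: "'e set" and x :: 'e and R I :: "'e \<Rightarrow> 'e bivector"
  assumes open_S: "open S" and x_S: "x \<in> S"
    and J_J: "J (J v) = - v"
    and smooth_I: "smooth_on S I"
    and R_alt: "y \<in> S \<Longrightarrow> R y a a = 0" and I_alt: "y \<in> S \<Longrightarrow> I y a a = 0"
    and R_I: "y \<in> S \<Longrightarrow> R y a b = I y (a o\<^sub>L J) b"
begin

definition D :: "'e \<Rightarrow>\<^sub>L 'e bivector" where "D = FD I x"

text \<open>
  In terms of \<open>\<pi> = R + i I\<close> with \<open>R = I \<circ> J\<^sup>*\<close>, this is one of the two real Cauchy-Riemann equations,
  \<open>D\<^sub>J\<^sub>u I = D\<^sub>u R\<close>. The other one, \<open>D\<^sub>J\<^sub>u R = - D\<^sub>u I\<close>, is the same with \<open>J u\<close> for \<open>u\<close>.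
\<close>

definition cauchy_riemann :: bool where "cauchy_riemann \<longleftrightarrow> (\<forall>u a b. D (J u) a b = D u (a o\<^sub>L J) b)"

lemma diff_I: "(I has_derivative D) (at x)"
  unfolding D_def by (rule has_derivative_FD[OF smooth_on_imp_differentiable[OF smooth_I x_S]])

lemma I_skew: "y \<in> S \<Longrightarrow> I y a b = - I y b a"
  by (rule alternating_skew) (rule I_alt)

lemma I_J: "y \<in> S \<Longrightarrow> I y (a o\<^sub>L J) b = I y a (b o\<^sub>L J)"
  by (rule type20_commutes[of "R y"]) (simp_all add: R_alt I_alt R_I)

lemma has_derivative_I_apply: "((\<lambda>y. I y a b) has_derivative (\<lambda>u. D u a b)) (at x)"
  by (intro bounded_linear.has_derivative[OF blinfun.bounded_linear_left] diff_I)

lemma FD_I_apply: "FD (\<lambda>y. I y a b) x u = D u a b"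
  by (simp add: FD_eqI[OF has_derivative_I_apply])

lemma FD_R_apply: "FD (\<lambda>y. R y a b) x u = D u (a o\<^sub>L J) b"
  using FD_cong[OF open_S x_S, of "\<lambda>y. R y a b" "\<lambda>y. I y (a o\<^sub>L J) b"] by (simp add: R_I FD_I_apply)

lemma D_skew: "D u a b = - D u b a"
proof -
  have "FD (\<lambda>y. I y a b) x = FD (\<lambda>y. - I y b a) x"
    by (rule FD_cong[OF open_S x_S]) (rule I_skew)
  then have "FD (\<lambda>y. I y a b) x u = FD (\<lambda>y. - I y b a) x u"
    by simp
  then show ?thesis
    by (simp add: FD_I_apply FD_eqI[OF has_derivative_minus[OF has_derivative_I_apply]])
qed

lemma D_J: "D u (a o\<^sub>L J) b = D u a (b o\<^sub>L J)"
proof -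
  have "FD (\<lambda>y. I y (a o\<^sub>L J) b) x = FD (\<lambda>y. I y a (b o\<^sub>L J)) x"
    by (rule FD_cong[OF open_S x_S]) (rule I_J)
  then have "FD (\<lambda>y. I y (a o\<^sub>L J) b) x u = FD (\<lambda>y. I y a (b o\<^sub>L J)) x u"
    by simp
  then show ?thesis
    by (simp add: FD_I_apply)
qed

lemmas o_J_J = compose_J_J[OF J_J]

lemma J_sharp: "J (sharp (I x) a) = sharp (I x) (a o\<^sub>L J)"
  by (rule covectors_separate)
    (metis I_J blinfun_apply_blinfun_compose sharp_apply x_S)

lemma sharp_R: "sharp (R x) a = J (sharp (I x) a)"
  unfolding J_sharp by (rule sharp_eqI) (simp add: sharp_apply R_I x_S)

lemma cauchy_riemann_D: "cauchy_riemann \<Longrightarrow> D (J u) a b = D u a (b o\<^sub>L J)"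
  by (simp add: cauchy_riemann_def D_J)

lemma schouten_II:
  "schouten I I x a b c = 2 * (D (sharp (I x) a) b c + D (sharp (I x) b) c a + D (sharp (I x) c) a b)"
  by (simp add: schouten_def schouten_term_def FD_I_apply)

lemma schouten_commute: "schouten P Q x a b c = schouten Q P x a b c"
  by (simp add: schouten_def schouten_term_def)

lemma schouten_RR: "cauchy_riemann \<Longrightarrow> schouten R R x a b c = - schouten I I x a b c"
  by (simp add: schouten_def schouten_term_def FD_I_apply FD_R_apply sharp_R cauchy_riemann_D D_J o_J_J
      blinfun.bilinear_simps)

text \<open>
  Each of the six terms of \<open>[R, I]\<close> equals \<open>D (I\<^sup>\<sharp> a) (J\<^sup>* b) c\<close> or one of its cyclic permutations;
  \<open>J\<^sup>*\<close> can then be collected on \<open>a\<close>, either within \<open>D u\<close> or through \<open>D (J u)\<close>.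
\<close>

lemma schouten_RI:
  assumes cauchy_riemann
  shows "schouten R I x a b c = schouten I I x (a o\<^sub>L J) b c"
proof -
  have "schouten R I x a b c = 2 * (D (sharp (I x) a) b (c o\<^sub>L J) + D (sharp (I x) b) c (a o\<^sub>L J)
      + D (sharp (I x) c) a (b o\<^sub>L J))"
    by (simp add: schouten_def schouten_term_def FD_I_apply FD_R_apply sharp_R cauchy_riemann_D[OF assms] D_J)
  also have "\<dots> = schouten I I x (a o\<^sub>L J) b c"
    by (simp add: schouten_II J_sharp[symmetric] cauchy_riemann_D[OF assms] D_J)
  finally show ?thesis .
qed

lemma cx_schouten_eq_0_iff:
  assumes cauchy_riemann
  shows "(\<forall>a b c. cx_bilin (\<lambda>P Q. schouten P Q x a b c) (R, I) (R, I) = 0)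
    \<longleftrightarrow> (\<forall>a b c. schouten I I x a b c = 0)"
  by (simp add: cx_bilin_def schouten_commute[of I R] schouten_RR[OF assms] schouten_RI[OF assms]
      zero_prod_def) blast

lemma has_derivative_sharp_I:
  assumes "(\<alpha> has_derivative \<alpha>') (at x)"
  shows "((\<lambda>y. sharp (I y) (\<alpha> y)) has_derivative (\<lambda>u. sharp (I x) (\<alpha>' u) + sharp (D u) (\<alpha> x))) (at x)"
  by (rule bounded_bilinear.FDERIV[OF bounded_bilinear_sharp diff_I assms])

end

text \<open>
  The \<open>dbar\<close>-equation only tests the Cauchy-Riemann condition on the covectors \<open>dx\<^sub>j\<close>. Its defect
  \<open>D (J v) a b - D v (J\<^sup>* a) b\<close> passes to \<open>J\<^sup>* a\<close> or \<open>J\<^sup>* b\<close> by replacing \<open>v\<close> with \<open>J v\<close>, up to sign, so it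
  also vanishes on the covectors \<open>dy\<^sub>j = - J\<^sup>* dx\<^sub>j\<close>, and together these form a basis.
\<close>

lemma dbar_holo_coeff_eq_0_iff:
  fixes R I :: "complex ^ 'n::finite \<Rightarrow> (complex ^ 'n) bivector"
  assumes "type20_germ J0 S x R I"
  shows "(\<forall>j k v. dbar (\<lambda>y. holo_coeff (R y, I y) j k) x v = 0) \<longleftrightarrow> type20_germ.cauchy_riemann J0 x I"
proof -
  interpret type20_germ J0 S x R I by fact
  let ?x = "\<lambda>j::'n. blinfun_inner_left (axis j 1) :: (complex ^ 'n) covector"
  have FD_coeff: "FD (\<lambda>y. holo_coeff (R y, I y) j k) x v =
      4 * (of_real (D v (?x j o\<^sub>L J0) (?x k)) + \<i> * of_real (D v (?x j) (?x k)))" for j k v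
  proof -
    have "FD (\<lambda>y. holo_coeff (R y, I y) j k) x =
        FD (\<lambda>y. 4 * (of_real (I y (?x j o\<^sub>L J0) (?x k)) + \<i> * of_real (I y (?x j) (?x k)))) x"
    proof (rule FD_cong[OF open_S x_S])
      fix y assume "y \<in> S"
      then show "holo_coeff (R y, I y) j k =
          4 * (of_real (I y (?x j o\<^sub>L J0) (?x k)) + \<i> * of_real (I y (?x j) (?x k)))"
        by (subst holo_coeff_eq) (simp_all add: R_I I_J)
    qed
    moreover have "((\<lambda>y. 4 * (complex_of_real (I y (?x j o\<^sub>L J0) (?x k)) + \<i> * of_real (I y (?x j) (?x k))))
        has_derivative (\<lambda>v. 4 * (of_real (D v (?x j o\<^sub>L J0) (?x k)) + \<i> * of_real (D v (?x j) (?x k))))) (at x)"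
      by (intro has_derivative_mult_right has_derivative_add has_derivative_of_real has_derivative_I_apply)
    ultimately show ?thesis
      by (simp add: FD_eqI)
  qed
  have dbar: "dbar (\<lambda>y. holo_coeff (R y, I y) j k) x v =
      2 * (of_real (D v (?x j o\<^sub>L J0) (?x k) - D (J0 v) (?x j) (?x k))
        + \<i> * of_real (D v (?x j) (?x k) + D (J0 v) (?x j o\<^sub>L J0) (?x k)))" for j k v
    by (simp add: dbar_def FD_coeff complex_eq_iff)
  show ?thesis
  proof
    assume cauchy_riemann
    then show "\<forall>j k v. dbar (\<lambda>y. holo_coeff (R y, I y) j k) x v = 0"
      unfolding dbar by (simp add: cauchy_riemann_def o_J_J blinfun.bilinear_simps)
  next
    assume *: "\<forall>j k v. dbar (\<lambda>y. holo_coeff (R y, I y) j k) x v = 0"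
    have x: "D (J0 v) (?x j) (?x k) = D v (?x j o\<^sub>L J0) (?x k)" for j k v
    proof -
      have "Re (dbar (\<lambda>y. holo_coeff (R y, I y) j k) x v) = 0"
        using * by simp
      then show ?thesis
        unfolding dbar by simp
    qed
    have y: "D (J0 v) (?x j o\<^sub>L J0) (?x k) = - D v (?x j) (?x k)" for j k v
      using x[of "J0 v" j k] by (simp add: J_J blinfun.bilinear_simps)
    have zero: "(D (J0 v) - twist (D v) J0) (blinfun_inner_left e) (blinfun_inner_left f) = 0"
      if "e \<in> Basis" "f \<in> Basis" for e f v
    proof -
      obtain j k where "e = axis j 1 \<or> e = axis j \<i>" "f = axis k 1 \<or> f = axis k \<i>"
        using \<open>e \<in> Basis\<close> \<open>f \<in> Basis\<close> by (auto simp: Basis_vec_def Basis_complex_def)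
      then show ?thesis
        by (auto simp: twist_def dual_map_apply dy_eq x y blinfun.bilinear_simps blinfun_compose_minus
            o_J_J D_J[symmetric])
    qed
    have "(D (J0 v) - twist (D v) J0) a b = 0" for v a b
      by (subst bivector_expand[symmetric]) (simp add: zero)
    then show cauchy_riemann
      by (simp add: cauchy_riemann_def twist_def dual_map_apply blinfun.bilinear_simps)
  qed
qed

section \<open>The Koszul bracket and the Courant bracket at a point\<close>

text \<open>
  In this form only one term involves a derivative of the bivector field, since the three
  occurrences of the derivative of \<open>P\<close> in the definition partly cancel by skewness.
\<close>

lemma koszul_bracket_eq:
  fixes P :: "'e::euclidean_space \<Rightarrow> 'e bivector"
  assumes P: "(P has_derivative P') (at x)" and \<alpha>: "(\<alpha> has_derivative \<alpha>') (at x)"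
    and \<beta>: "(\<beta> has_derivative \<beta>') (at x)"
    and skew: "\<And>a b. P x a b = - P x b a" "\<And>u a b. P' u a b = - P' u b a"
  shows "koszul_bracket P \<alpha> \<beta> x u =
    \<beta>' (sharp (P x) (\<alpha> x)) u - \<alpha>' (sharp (P x) (\<beta> x)) u + P' u (\<alpha> x) (\<beta> x)"
proof -
  note FD_sharp = FD_eqI[OF bounded_bilinear.FDERIV[OF bounded_bilinear_sharp P \<alpha>]]
    FD_eqI[OF bounded_bilinear.FDERIV[OF bounded_bilinear_sharp P \<beta>]]
  have "((\<lambda>y. P y (\<alpha> y) (\<beta> y)) has_derivative
      (\<lambda>u. P x (\<alpha> x) (\<beta>' u) + (P x (\<alpha>' u) + P' u (\<alpha> x)) (\<beta> x))) (at x)"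
    by (intro bounded_bilinear.FDERIV[OF bounded_bilinear_blinfun_apply] P \<alpha> \<beta>)
  note FD_P = FD_eqI[OF this]
  show ?thesis
    unfolding koszul_bracket_def lie_form_def
    using skew(1)[of "\<alpha>' u" "\<beta> x"] skew(1)[of "\<beta>' u" "\<alpha> x"] skew(2)[of u "\<beta> x" "\<alpha> x"]
    by (simp add: FD_sharp FD_P FD_eqI[OF \<alpha>] FD_eqI[OF \<beta>] blinfun.bilinear_simps sharp_apply)
qed

lemma nijenhuis_torsion_const:
  fixes N :: "'e::euclidean_space \<Rightarrow>\<^sub>L 'e"
  assumes V: "V differentiable (at x)" and W: "W differentiable (at x)"
  shows "nijenhuis_torsion (\<lambda>_. N) V W x = 0"
proof -
  have "FD (\<lambda>y. N (U y)) x u = N (FD U x u)" if "U differentiable (at x)" for U u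
    using FD_eqI[OF bounded_linear.has_derivative[OF blinfun.bounded_linear_right[of N] has_derivative_FD[OF that]]]
    by simp
  then show ?thesis
    using V W by (simp add: nijenhuis_torsion_def Let_def lie_bracket_def blinfun.bilinear_simps)
qed

lemma FD_fst_snd:
  assumes "(s has_derivative s') (at x)"
  shows "FD (\<lambda>y. fst (s y)) x u = fst (s' u)" "FD (\<lambda>y. snd (s y)) x u = snd (s' u)"
  by (simp_all add: FD_eqI[OF has_derivative_fst[OF assms]] FD_eqI[OF has_derivative_snd[OF assms]])

text \<open>
  The tensorial expressions in the Courant bracket are computed by linear algebra on this first-order data
  of the two sections.
\<close>

lemma courant_bracket_eq:
  fixes s t :: "'e::euclidean_space \<Rightarrow> 'e \<times> 'e covector"
  assumes s: "(s has_derivative s') (at x)" and t: "(t has_derivative t') (at x)"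
  shows "fst (courant_bracket s t x) = fst (t' (fst (s x))) - fst (s' (fst (t x)))"
    and "blinfun_apply (snd (courant_bracket s t x)) u =
      blinfun_apply (snd (t' (fst (s x)))) u - blinfun_apply (snd (s' (fst (t x)))) u
      + (1/2) * (blinfun_apply (snd (t x)) (fst (s' u)) - blinfun_apply (snd (s x)) (fst (t' u))
        + blinfun_apply (snd (s' u)) (fst (t x)) - blinfun_apply (snd (t' u)) (fst (s x)))"
proof -
  show "fst (courant_bracket s t x) = fst (t' (fst (s x))) - fst (s' (fst (t x)))"
    by (simp add: courant_bracket_def Let_def lie_bracket_def FD_fst_snd[OF s] FD_fst_snd[OF t])
  have "((\<lambda>y. blinfun_apply (snd (s y)) (fst (t y)) - blinfun_apply (snd (t y)) (fst (s y))) has_derivative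
      (\<lambda>u. (blinfun_apply (snd (s x)) (fst (t' u)) + blinfun_apply (snd (s' u)) (fst (t x)))
         - (blinfun_apply (snd (t x)) (fst (s' u)) + blinfun_apply (snd (t' u)) (fst (s x))))) (at x)"
    by (intro has_derivative_diff bounded_bilinear.FDERIV[OF bounded_bilinear_blinfun_apply]
        has_derivative_fst has_derivative_snd s t)
  from FD_eqI[OF this]
  show "blinfun_apply (snd (courant_bracket s t x)) u =
      blinfun_apply (snd (t' (fst (s x)))) u - blinfun_apply (snd (s' (fst (t x)))) u
      + (1/2) * (blinfun_apply (snd (t x)) (fst (s' u)) - blinfun_apply (snd (s x)) (fst (t' u))
        + blinfun_apply (snd (s' u)) (fst (t x)) - blinfun_apply (snd (t' u)) (fst (s x)))"
    by (simp add: courant_bracket_def Let_def lie_form_def FD_fst_snd[OF s] FD_fst_snd[OF t]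
        blinfun.bilinear_simps field_simps)
qed

lemma courant_bracket_scale:
  fixes s t :: "'e::euclidean_space \<Rightarrow> 'e \<times> 'e covector"
  assumes s: "(s has_derivative s') (at x)" and t: "(t has_derivative t') (at x)"
  shows "courant_bracket (\<lambda>y. r *\<^sub>R s y) t x = r *\<^sub>R courant_bracket s t x"
    and "courant_bracket s (\<lambda>y. r *\<^sub>R t y) x = r *\<^sub>R courant_bracket s t x"
proof -
  have "linear s'" "linear t'"
    using s t has_derivative_linear by blast+
  note lin = linear_cmul[OF this(1)] linear_cmul[OF this(2)]
  note rs = has_derivative_scaleR_right[OF s, of r] and rt = has_derivative_scaleR_right[OF t, of r]
  show "courant_bracket (\<lambda>y. r *\<^sub>R s y) t x = r *\<^sub>R courant_bracket s t x"
    by (intro prod_eqI blinfun_eqI; simp add: courant_bracket_eq[OF rs t] courant_bracket_eq[OF s t]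
        lin blinfun.bilinear_simps algebra_simps)
  show "courant_bracket s (\<lambda>y. r *\<^sub>R t y) x = r *\<^sub>R courant_bracket s t x"
    by (intro prod_eqI blinfun_eqI; simp add: courant_bracket_eq[OF s rt] courant_bracket_eq[OF s t]
        lin blinfun.bilinear_simps algebra_simps)
qed

lemma courant_bracket_cong:
  assumes "open S" "x \<in> S" "\<And>y. y \<in> S \<Longrightarrow> s y = s' y" "\<And>y. y \<in> S \<Longrightarrow> t y = t' y"
  shows "courant_bracket s t x = courant_bracket s' t' x"
proof -
  note cong = FD_cong[OF assms(1,2)]
  have "FD (\<lambda>y. fst (s y)) x = FD (\<lambda>y. fst (s' y)) x" "FD (\<lambda>y. snd (s y)) x = FD (\<lambda>y. snd (s' y)) x"
    "FD (\<lambda>y. fst (t y)) x = FD (\<lambda>y. fst (t' y)) x" "FD (\<lambda>y. snd (t y)) x = FD (\<lambda>y. snd (t' y)) x"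
    "FD (\<lambda>y. blinfun_apply (snd (s y)) (fst (t y)) - blinfun_apply (snd (t y)) (fst (s y))) x =
      FD (\<lambda>y. blinfun_apply (snd (s' y)) (fst (t' y)) - blinfun_apply (snd (t' y)) (fst (s' y))) x"
    by (rule cong; simp add: assms)+
  then show ?thesis
    using assms(2-4) by (simp add: courant_bracket_def Let_def lie_bracket_def lie_form_def)
qed

section \<open>The two integrability conditions at a point\<close>

context type20_germ
begin

text \<open>
  The terms with derivatives of \<open>\<alpha>\<close> and \<open>\<beta>\<close> cancel, because \<open>J\<close> is constant and
  \<open>J I\<^sup>\<sharp> = I\<^sup>\<sharp> J\<^sup>*\<close>. What is left are the derivatives of the bivector in the four brackets.
\<close>

lemma koszul_concomitant:
  assumes \<alpha>: "(\<alpha> has_derivative \<alpha>') (at x)" and \<beta>: "(\<beta> has_derivative \<beta>') (at x)"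
  shows "(koszul_bracket (\<lambda>y. twist (I y) J) \<alpha> \<beta> x - koszul_bracket I (\<lambda>y. dual_map J (\<alpha> y)) \<beta> x
      - koszul_bracket I \<alpha> (\<lambda>y. dual_map J (\<beta> y)) x + dual_map J (koszul_bracket I \<alpha> \<beta> x)) u
    = D (J u) (\<alpha> x) (\<beta> x) - D u (\<alpha> x) (\<beta> x o\<^sub>L J)"
proof -
  have tw: "((\<lambda>y. twist (I y) J) has_derivative (\<lambda>u. twist (D u) J)) (at x)"
    unfolding twist_def
    by (intro bounded_linear.has_derivative[OF bounded_bilinear.bounded_linear_left[OF bounded_bilinear_blinfun_compose]]
        diff_I)
  have J: "((\<lambda>y. \<gamma> y o\<^sub>L J) has_derivative (\<lambda>u. \<gamma>' u o\<^sub>L J)) (at x)"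
    if "(\<gamma> has_derivative \<gamma>') (at x)" for \<gamma> \<gamma>'
    by (intro bounded_linear.has_derivative[OF bounded_bilinear.bounded_linear_left[OF bounded_bilinear_blinfun_compose]]
        that)
  have app: "twist P J a b = P (a o\<^sub>L J) b" for P a b
    by (simp add: twist_def dual_map_apply)
  have sk: "I x a b = - I x b a" for a b
    by (rule I_skew[OF x_S])
  have 1: "koszul_bracket (\<lambda>y. twist (I y) J) \<alpha> \<beta> x u =
     \<beta>' (sharp (twist (I x) J) (\<alpha> x)) u - \<alpha>' (sharp (twist (I x) J) (\<beta> x)) u + twist (D u) J (\<alpha> x) (\<beta> x)"
  proof (rule koszul_bracket_eq[OF tw \<alpha> \<beta>])
    show "twist (I x) J a b = - twist (I x) J b a" for a b
      using sk[of "a o\<^sub>L J" b] by (simp add: app I_J[OF x_S])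
    show "twist (D v) J a b = - twist (D v) J b a" for v a b
      using D_skew[of v "a o\<^sub>L J" b] by (simp add: app D_J)
  qed
  show ?thesis
    unfolding dual_map_apply
    by (simp add: 1 koszul_bracket_eq[OF diff_I \<alpha> \<beta> sk D_skew] koszul_bracket_eq[OF diff_I J[OF \<alpha>] \<beta> sk D_skew]
        koszul_bracket_eq[OF diff_I \<alpha> J[OF \<beta>] sk D_skew] blinfun.bilinear_simps app sharp_twist
        dual_map_apply D_J)
qed

abbreviation K :: "'e \<Rightarrow> 'e gen_endo" where "K y \<equiv> block_endo J (I y)"

lemma K_K: "y \<in> S \<Longrightarrow> K y (K y u) = - u"
proof -
  assume y: "y \<in> S"
  have "J (sharp (I y) a) = sharp (I y) (a o\<^sub>L J)" for a
    by (rule covectors_separate) (metis I_J y blinfun_apply_blinfun_compose sharp_apply)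
  then show ?thesis
    by (simp add: block_endo_apply blinfun.bilinear_simps J_J dual_map_apply o_J_J prod_eq_iff
        bounded_bilinear.minus_right[OF bounded_bilinear_sharp] blinfun_compose_minus)
qed

lemma pairing_K_K:
  assumes y: "y \<in> S"
  shows "pairing (K y u) (K y w) = pairing u w"
proof -
  have "I y (snd w) (snd u o\<^sub>L J) = - I y (snd u) (snd w o\<^sub>L J)"
    by (subst I_skew[OF y], simp add: I_J[OF y])
  then show ?thesis
    by (simp add: pairing_def block_endo_apply blinfun.bilinear_simps J_J dual_map_apply covector_J_sharp)
qed

lemma has_derivative_K:
  assumes s: "(s has_derivative s') (at x)"
  shows "((\<lambda>y. K y (s y)) has_derivative
    (\<lambda>u. (J (fst (s' u)) + (sharp (I x) (snd (s' u)) + sharp (D u) (snd (s x))), - (snd (s' u) o\<^sub>L J)))) (at x)"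
  unfolding block_endo_apply dual_map_apply
  by (intro has_derivative_Pair has_derivative_add has_derivative_minus has_derivative_sharp_I
      bounded_linear.has_derivative[OF blinfun.bounded_linear_right]
      bounded_linear.has_derivative[OF bounded_bilinear.bounded_linear_left[OF bounded_bilinear_blinfun_compose]]
      has_derivative_fst has_derivative_snd s)

text \<open>
  The Nijenhuis torsion of \<open>K\<close> with respect to the Courant bracket; its term \<open>K\<^sup>2 [s, t]\<close> is
  written as \<open>- [s, t]\<close>.
\<close>

definition torsion where
  "torsion s t = courant_bracket (\<lambda>y. K y (s y)) (\<lambda>y. K y (t y)) x
     - K x (courant_bracket (\<lambda>y. K y (s y)) t x + courant_bracket s (\<lambda>y. K y (t y)) x)
     - courant_bracket s t x"

text \<open>
  The terms with derivatives of \<open>s\<close> and \<open>t\<close> cancel because \<open>K\<^sup>2 = - 1\<close> and \<open>K\<close> is skew for the pairing.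
\<close>

lemma snd_torsion:
  assumes s: "(s has_derivative s') (at x)" and t: "(t has_derivative t') (at x)"
  shows "blinfun_apply (snd (torsion s t)) u = D (J u) (snd (s x)) (snd (t x)) - D u (snd (s x)) (snd (t x) o\<^sub>L J)"
proof -
  define Ks where "Ks = (\<lambda>y. K y (s y))"
  define Kt where "Kt = (\<lambda>y. K y (t y))"
  note dKs = has_derivative_K[OF s, folded Ks_def] and dKt = has_derivative_K[OF t, folded Kt_def]
  have x: "Ks x = (J (fst (s x)) + sharp (I x) (snd (s x)), - (snd (s x) o\<^sub>L J))"
    "Kt x = (J (fst (t x)) + sharp (I x) (snd (t x)), - (snd (t x) o\<^sub>L J))"
    by (simp_all add: Ks_def Kt_def block_endo_apply dual_map_apply)
  have I_skew': "I x (snd (s' v)) a = - I x a (snd (s' v))" "I x (snd (t' v)) a = - I x a (snd (t' v))" for v a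
    by (rule I_skew[OF x_S])+
  have D_skew': "D v (snd (t x)) (snd (s x)) = - D v (snd (s x)) (snd (t x))"
    "D v (snd (t x)) (snd (s x) o\<^sub>L J) = - D v (snd (s x)) (snd (t x) o\<^sub>L J)" for v
    by (subst D_skew, simp add: D_J)+
  have "linear s'" "linear t'"
    using s t has_derivative_linear by blast+
  note lin = linear_neg[OF this(1)] linear_neg[OF this(2)] linear_add[OF this(1)] linear_add[OF this(2)]
  show ?thesis
    unfolding torsion_def Ks_def[symmetric] Kt_def[symmetric]
    by (simp add: courant_bracket_eq[OF s t] courant_bracket_eq[OF s dKt] courant_bracket_eq[OF dKs t]
        courant_bracket_eq[OF dKs dKt] x block_endo_apply dual_map_apply blinfun.bilinear_simps J_J covector_J_sharp
        sharp_apply lin I_J[OF x_S] D_J o_J_J I_skew' D_skew' algebra_simps)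
qed

text \<open>
  The Cauchy-Riemann condition lets the terms with \<open>D (J V)\<close> cancel those with \<open>D V\<close>, where \<open>V\<close> is a
  tangent component of \<open>s\<close> or \<open>t\<close>. For the cotangent components \<open>\<xi>\<close> and \<open>\<eta>\<close>, the remaining terms
  \<open>D (I\<^sup>\<sharp> \<xi>) \<eta> c\<close>, \<open>D (I\<^sup>\<sharp> \<eta>) c \<xi>\<close> and \<open>D (I\<^sup>\<sharp> c) \<xi> \<eta>\<close> form the Jacobi sum.
\<close>

lemma fst_torsion:
  fixes c :: "'e covector"
  assumes s: "(s has_derivative s') (at x)" and t: "(t has_derivative t') (at x)" and cauchy_riemann
  shows "2 * c (fst (torsion s t)) = schouten I I x (snd (s x)) (snd (t x)) c"
proof -
  define Ks where "Ks = (\<lambda>y. K y (s y))"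
  define Kt where "Kt = (\<lambda>y. K y (t y))"
  note dKs = has_derivative_K[OF s, folded Ks_def] and dKt = has_derivative_K[OF t, folded Kt_def]
  have x: "Ks x = (J (fst (s x)) + sharp (I x) (snd (s x)), - (snd (s x) o\<^sub>L J))"
    "Kt x = (J (fst (t x)) + sharp (I x) (snd (t x)), - (snd (t x) o\<^sub>L J))"
    by (simp_all add: Ks_def Kt_def block_endo_apply dual_map_apply)
  have I_skew': "I x (snd (s' v)) a = - I x a (snd (s' v))" "I x (snd (t' v)) a = - I x a (snd (t' v))" for v a
    by (rule I_skew[OF x_S])+
  have D_skew': "D v (snd (t x)) (snd (s x)) = - D v (snd (s x)) (snd (t x))"
    "D v (snd (t x)) (snd (s x) o\<^sub>L J) = - D v (snd (s x)) (snd (t x) o\<^sub>L J)"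
    "D v c (snd (s x)) = - D v (snd (s x)) c"
    "D v c (snd (s x) o\<^sub>L J) = - D v (snd (s x)) (c o\<^sub>L J)" for v
    by (subst D_skew, simp add: D_J)+
  have "linear s'" "linear t'"
    using s t has_derivative_linear by blast+
  note lin = linear_neg[OF this(1)] linear_neg[OF this(2)] linear_add[OF this(1)] linear_add[OF this(2)]
  \<comment> \<open>This turns the cotangent part of the brackets, to which the sharp map is applied, into its value
    at a vector, where the formula for the bracket applies.\<close>
  have sh: "c (sharp (I x) \<phi>) = - \<phi> (sharp (I x) c)" for \<phi>
    by (simp add: sharp_apply I_skew[OF x_S, of \<phi> c])
  show ?thesis
    unfolding torsion_def Ks_def[symmetric] Kt_def[symmetric]
    by (simp add: sh courant_bracket_eq[OF s t] courant_bracket_eq[OF s dKt] courant_bracket_eq[OF dKs t]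
        courant_bracket_eq[OF dKs dKt] x block_endo_apply dual_map_apply blinfun.bilinear_simps J_J covector_J_sharp
        lin I_J[OF x_S] D_J o_J_J cauchy_riemann_D[OF \<open>cauchy_riemann\<close>] I_skew' D_skew' schouten_II algebra_simps)
      (simp add: sharp_apply blinfun.bilinear_simps I_skew' D_skew' D_J cauchy_riemann_D[OF \<open>cauchy_riemann\<close>] algebra_simps)
qed

lemma torsion_eq_0_iff:
  assumes s: "(s has_derivative s') (at x)" and t: "(t has_derivative t') (at x)" and cauchy_riemann
  shows "torsion s t = 0 \<longleftrightarrow> (\<forall>c. schouten I I x (snd (s x)) (snd (t x)) c = 0)"
proof -
  have "snd (torsion s t) = 0"
    using \<open>cauchy_riemann\<close> by (intro blinfun_eqI) (simp add: snd_torsion[OF s t] cauchy_riemann_D)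
  moreover have "fst (torsion s t) = 0 \<longleftrightarrow> (\<forall>c::'e covector. 2 * c (fst (torsion s t)) = 0)"
    by (auto intro: covectors_separate simp: blinfun.bilinear_simps)
  ultimately show ?thesis
    by (simp only: fst_torsion[OF s t \<open>cauchy_riemann\<close>] prod_eq_iff fst_zero snd_zero simp_thms)
qed

text \<open>
  For \<open>\<epsilon> = \<plusminus>1\<close>, the pairs \<open>(s, - \<epsilon> K s)\<close> are the sections of the eigenbundle for \<open>\<epsilon> i\<close>. With
  \<open>p = [s, t]\<close>, \<open>q = [K s, K t]\<close> and \<open>r = [K s, t] + [s, K t]\<close>, the bracket of two of them is
  \<open>(p - q) - \<epsilon> i r\<close>. It belongs to the same eigenbundle if and only if \<open>K r = q - p\<close>.
\<close>

lemma courant_eigen_iff: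
  assumes s: "(s has_derivative s') (at x)" and t: "(t has_derivative t') (at x)" and \<epsilon>: "\<epsilon> * \<epsilon> = (1::real)"
    and s2: "\<And>y. y \<in> S \<Longrightarrow> s2 y = (- \<epsilon>) *\<^sub>R K y (s y)" and t2: "\<And>y. y \<in> S \<Longrightarrow> t2 y = (- \<epsilon>) *\<^sub>R K y (t y)"
  shows "(let b = cx_bilin (\<lambda>s t. courant_bracket s t x) (s, s2) (t, t2)
      in cx_map (K x) b = cx_scale (Complex 0 \<epsilon>) b) \<longleftrightarrow> torsion s t = 0"
proof -
  note dKs = has_derivative_K[OF s] and dKt = has_derivative_K[OF t]
  define p where "p = courant_bracket s t x"
  define q where "q = courant_bracket (\<lambda>y. K y (s y)) (\<lambda>y. K y (t y)) x"
  define r where "r = courant_bracket (\<lambda>y. K y (s y)) t x + courant_bracket s (\<lambda>y. K y (t y)) x"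
  note cong = courant_bracket_cong[OF open_S x_S]
  have 1: "courant_bracket s t2 x = (- \<epsilon>) *\<^sub>R courant_bracket s (\<lambda>y. K y (t y)) x"
    by (rule trans[OF cong[OF refl t2] courant_bracket_scale(2)[OF s dKt]])
  have 2: "courant_bracket s2 t x = (- \<epsilon>) *\<^sub>R courant_bracket (\<lambda>y. K y (s y)) t x"
    by (rule trans[OF cong[OF s2 refl] courant_bracket_scale(1)[OF dKs t]])
  have "courant_bracket s2 t2 x = (- \<epsilon>) *\<^sub>R (- \<epsilon>) *\<^sub>R q"
    unfolding q_def
    by (rule trans[OF cong[OF s2 t2] trans[OF courant_bracket_scale(1)[OF dKs has_derivative_scaleR_right[OF dKt]]
          arg_cong[where f = "\<lambda>z. (- \<epsilon>) *\<^sub>R z", OF courant_bracket_scale(2)[OF dKs dKt]]]])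
  then have 3: "courant_bracket s2 t2 x = q"
    using \<epsilon> by simp
  have b: "cx_bilin (\<lambda>s t. courant_bracket s t x) (s, s2) (t, t2) = (p - q, (- \<epsilon>) *\<^sub>R r)"
    by (simp add: cx_bilin_def 1 2 3 p_def r_def algebra_simps)
  have t: "torsion s t = q - K x r - p"
    by (simp add: torsion_def p_def q_def r_def)
  have Krr: "K x (K x r) = - r"
    by (rule K_K[OF x_S])
  have "(K x (p - q), K x ((- \<epsilon>) *\<^sub>R r)) = (\<epsilon> *\<^sub>R \<epsilon> *\<^sub>R r, \<epsilon> *\<^sub>R (p - q)) \<longleftrightarrow> q - K x r - p = 0"
  proof
    assume "(K x (p - q), K x ((- \<epsilon>) *\<^sub>R r)) = (\<epsilon> *\<^sub>R \<epsilon> *\<^sub>R r, \<epsilon> *\<^sub>R (p - q))"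
    then have "\<epsilon> *\<^sub>R \<epsilon> *\<^sub>R (q - K x r - p) = 0"
      by (simp add: blinfun.bilinear_simps algebra_simps)
    then show "q - K x r - p = 0"
      using \<epsilon> by simp
  next
    assume "q - K x r - p = 0"
    then have Kr: "K x r = q - p"
      by (simp add: algebra_simps)
    have "K x (p - q) = - K x (K x r)"
      by (simp add: Kr blinfun.diff_right)
    then have "K x (p - q) = r"
      by (simp add: Krr)
    moreover have "K x ((- \<epsilon>) *\<^sub>R r) = \<epsilon> *\<^sub>R (p - q)"
      by (simp add: blinfun.scaleR_right blinfun.minus_right Kr scaleR_diff_right)
    ultimately show "(K x (p - q), K x ((- \<epsilon>) *\<^sub>R r)) = (\<epsilon> *\<^sub>R \<epsilon> *\<^sub>R r, \<epsilon> *\<^sub>R (p - q))"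
      using \<epsilon> by simp
  qed
  then show ?thesis
    by (simp add: Let_def b t cx_map_def cx_scale_def)
qed

lemma cx_map_K_iff:
  assumes "y \<in> S" "\<epsilon> * \<epsilon> = (1::real)"
  shows "cx_map (K y) (u, w) = cx_scale (Complex 0 \<epsilon>) (u, w) \<longleftrightarrow> w = (- \<epsilon>) *\<^sub>R K y u"
proof
  assume "cx_map (K y) (u, w) = cx_scale (Complex 0 \<epsilon>) (u, w)"
  then have "K y u = - \<epsilon> *\<^sub>R w"
    by (simp add: cx_map_def cx_scale_def)
  then have "(- \<epsilon>) *\<^sub>R K y u = (\<epsilon> * \<epsilon>) *\<^sub>R w"
    by simp
  then show "w = (- \<epsilon>) *\<^sub>R K y u"
    using assms(2) by simp
next
  assume "w = (- \<epsilon>) *\<^sub>R K y u"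
  then show "cx_map (K y) (u, w) = cx_scale (Complex 0 \<epsilon>) (u, w)"
    using assms(2) by (simp add: cx_map_def cx_scale_def blinfun.bilinear_simps K_K[OF assms(1)])
qed

end

text \<open>
  The block endomorphism is an affine function of the bivector. Its linear part is written as a sum of
  compositions of bounded linear maps, which shows that it is bounded.
\<close>

lemma smooth_on_block_endo:
  fixes P :: "'e::euclidean_space \<Rightarrow> 'f::euclidean_space bivector"
  assumes "open S" "smooth_on S P"
  shows "smooth_on S (\<lambda>y. block_endo N (P y))"
proof -
  define L :: "'f bivector \<Rightarrow> 'f gen_endo" where
    "L Q = (\<Sum>e\<in>Basis. blinfun_scaleR_left (e, 0) o\<^sub>L (blinfun.prod_left (blinfun_inner_left e) o\<^sub>L (Q o\<^sub>L snd_blinfun)))" for Q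
  have "bounded_linear L"
    unfolding L_def
    by (intro bounded_linear_sum
        bounded_linear_compose[OF bounded_bilinear.bounded_linear_right[OF bounded_bilinear_blinfun_compose]]
        bounded_bilinear.bounded_linear_left[OF bounded_bilinear_blinfun_compose])
  moreover have "block_endo N Q = block_endo N 0 + L Q" for Q
  proof (rule blinfun_eqI)
    fix u
    have "sharp 0 a = 0" for a :: "'f covector"
      by (rule sharp_eqI) (simp add: blinfun.bilinear_simps)
    then show "block_endo N Q u = (block_endo N 0 + L Q) u"
      by (auto simp: block_endo_apply L_def blinfun.bilinear_simps blinfun.sum_left sharp_eq_sum
          prod_eq_iff fst_sum snd_sum)
  qed
  then have eq: "(\<lambda>y. block_endo N (P y)) = (\<lambda>y. block_endo N 0 + L (P y))"
    by (intro ext)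
  ultimately show ?thesis
    unfolding eq
    by (intro smooth_on_add[OF assms(1) smooth_on_const smooth_on_bounded_linear[OF assms(1) _ assms(2)]])
qed

lemma gen_section_has_derivative:
  assumes "gen_section A s" "c \<in> A" "x \<in> chart_image c"
  shows "(s c has_derivative FD (s c) x) (at x)"
proof (rule has_derivative_FD)
  have "(\<lambda>y. fst (s c y)) differentiable (at x)" "(\<lambda>y. snd (s c y)) differentiable (at x)"
    using assms unfolding gen_section_def vector_field_def one_form_def
    by (auto intro: smooth_on_imp_differentiable)
  then obtain V' \<xi>' where "((\<lambda>y. fst (s c y)) has_derivative V') (at x)"
    "((\<lambda>y. snd (s c y)) has_derivative \<xi>') (at x)"
    unfolding differentiable_def by blast
  from has_derivative_Pair[OF this] show "s c differentiable (at x)"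
    by (simp add: differentiableI)
qed

section \<open>Global bivector fields of type (2,0)\<close>

text \<open>
  The situation after the algebraic condition is settled. In it each of the three structures is equivalent
  to the conjunction of the two pointwise conditions \<open>holomorphic\<close> and \<open>poisson_I\<close>.
\<close>

locale type20_bivector =
  fixes A :: "('a::{t2_space, second_countable_topology}, 'n::finite) chart set"
    and \<pi>R \<pi>I :: "('a, 'n) chart \<Rightarrow> complex ^ 'n \<Rightarrow> (complex ^ 'n) bivector"
  assumes A: "complex_manifold A"
    and \<pi>R: "bivector_field A \<pi>R" and \<pi>I: "bivector_field A \<pi>I"
    and \<pi>R_\<pi>I: "\<And>c x a b. c \<in> A \<Longrightarrow> x \<in> chart_image c \<Longrightarrow> \<pi>R c x a b = \<pi>I c x (a o\<^sub>L J0) b"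
begin

lemma germ: "c \<in> A \<Longrightarrow> x \<in> chart_image c \<Longrightarrow> type20_germ J0 (chart_image c) x (\<pi>R c) (\<pi>I c)"
  using \<pi>R \<pi>I \<pi>R_\<pi>I complex_manifoldD(2)[OF A] J0_J0
  by unfold_locales (auto simp: bivector_field_def)

definition holomorphic :: bool where
  "holomorphic \<longleftrightarrow> (\<forall>c\<in>A. \<forall>x\<in>chart_image c. type20_germ.cauchy_riemann J0 x (\<pi>I c))"

definition poisson_I :: bool where
  "poisson_I \<longleftrightarrow> (\<forall>c\<in>A. \<forall>x\<in>chart_image c. \<forall>a1 a2 a3. schouten (\<pi>I c) (\<pi>I c) x a1 a2 a3 = 0)"

lemma holomorphic_poisson_iff: "holomorphic_poisson A (\<pi>R, \<pi>I) \<longleftrightarrow> holomorphic \<and> poisson_I"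
proof -
  have wedge: "(\<pi>R c x, \<pi>I c x) \<in> wedge2_T10 (Jfield c x)" if "c \<in> A" "x \<in> chart_image c" for c x
    using that \<pi>R \<pi>I \<pi>R_\<pi>I unfolding Jfield_def
    by (subst wedge2_T10_iff) (auto simp: J0_J0 bivector_field_def)
  have dbar: "(\<forall>j k v. dbar (\<lambda>y. holo_coeff (\<pi>R c y, \<pi>I c y) j k) x v = 0) \<longleftrightarrow> type20_germ.cauchy_riemann J0 x (\<pi>I c)"
    if "c \<in> A" "x \<in> chart_image c" for c x
    by (rule dbar_holo_coeff_eq_0_iff[OF germ[OF that]])
  have schouten: "(\<forall>a b d. cx_bilin (\<lambda>P Q. schouten P Q x a b d) (\<pi>R c, \<pi>I c) (\<pi>R c, \<pi>I c) = 0)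
      \<longleftrightarrow> (\<forall>a b d. schouten (\<pi>I c) (\<pi>I c) x a b d = 0)"
    if "c \<in> A" "x \<in> chart_image c" "type20_germ.cauchy_riemann J0 x (\<pi>I c)" for c x
    by (rule type20_germ.cx_schouten_eq_0_iff[OF germ[OF that(1,2)] that(3)])
  have "holomorphic_poisson A (\<pi>R, \<pi>I) \<longleftrightarrow> holomorphic \<and>
      (\<forall>c\<in>A. \<forall>x\<in>chart_image c. \<forall>a b d.
        cx_bilin (\<lambda>P Q. schouten P Q x a b d) (\<pi>R c, \<pi>I c) (\<pi>R c, \<pi>I c) = 0)"
    by (simp only: holomorphic_poisson_def fst_conv snd_conv \<pi>R \<pi>I wedge dbar holomorphic_def simp_thms ball_triv
        cong: ball_cong)
  also have "\<dots> \<longleftrightarrow> holomorphic \<and> poisson_I"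
    unfolding holomorphic_def poisson_I_def using schouten by blast
  finally show ?thesis .
qed

lemma one_form_has_derivative:
  "one_form A \<alpha> \<Longrightarrow> c \<in> A \<Longrightarrow> x \<in> chart_image c \<Longrightarrow> (\<alpha> c has_derivative FD (\<alpha> c) x) (at x)"
  by (rule has_derivative_FD[OF smooth_on_imp_differentiable[of "chart_image c"]]) (simp_all add: one_form_def)

lemma poisson_nijenhuis_iff: "poisson_nijenhuis A \<pi>I Jfield \<longleftrightarrow> holomorphic \<and> poisson_I"
proof -
  have J: "Jfield c = (\<lambda>_. J0)" for c :: "('a, 'n) chart"
    by (simp add: Jfield_def fun_eq_iff)
  have "endo_field A Jfield"
    unfolding endo_field_def J
    by (auto intro!: smooth_on_const blinfun_eqI simp: jac_J0[OF A])
  moreover have "nijenhuis_torsion (Jfield c) (V c) (W c) x = 0"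
    if "vector_field A V" "vector_field A W" "c \<in> A" "x \<in> chart_image c" for V W c x
    unfolding J using that unfolding vector_field_def
    by (intro nijenhuis_torsion_const) (auto intro: smooth_on_imp_differentiable)
  moreover have "Jfield c x (sharp (\<pi>I c x) a) = sharp (\<pi>I c x) (dual_map (Jfield c x) a)"
    if "c \<in> A" "x \<in> chart_image c" for c x a
    using type20_germ.J_sharp[OF germ[OF that]] by (simp add: J dual_map_apply)
  moreover have "holomorphic \<longleftrightarrow> (\<forall>\<alpha> \<beta>. one_form A \<alpha> \<longrightarrow> one_form A \<beta> \<longrightarrow>
      (\<forall>c\<in>A. \<forall>x\<in>chart_image c.
         koszul_bracket (\<lambda>y. twist (\<pi>I c y) (Jfield c y)) (\<alpha> c) (\<beta> c) x =
           koszul_bracket (\<pi>I c) (\<lambda>y. dual_map (Jfield c y) (\<alpha> c y)) (\<beta> c) x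
           + koszul_bracket (\<pi>I c) (\<alpha> c) (\<lambda>y. dual_map (Jfield c y) (\<beta> c y)) x
           - dual_map (Jfield c x) (koszul_bracket (\<pi>I c) (\<alpha> c) (\<beta> c) x)))"
    (is "_ \<longleftrightarrow> (\<forall>\<alpha> \<beta>. one_form A \<alpha> \<longrightarrow> one_form A \<beta> \<longrightarrow> (\<forall>c\<in>A. \<forall>x\<in>chart_image c. ?L \<alpha> \<beta> c x = ?R \<alpha> \<beta> c x))")
  proof -
    have eq: "(?L \<alpha> \<beta> c x - ?R \<alpha> \<beta> c x) u =
        type20_germ.D x (\<pi>I c) (J0 u) (\<alpha> c x) (\<beta> c x) - type20_germ.D x (\<pi>I c) u (\<alpha> c x o\<^sub>L J0) (\<beta> c x)"
      if "one_form A \<alpha>" "one_form A \<beta>" "c \<in> A" "x \<in> chart_image c" for \<alpha> \<beta> c x u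
    proof -
      interpret type20_germ J0 "chart_image c" x "\<pi>R c" "\<pi>I c"
        by (rule germ) fact+
      show ?thesis
        using koszul_concomitant[OF one_form_has_derivative[OF that(1,3,4)] one_form_has_derivative[OF that(2,3,4)], of u]
        by (simp add: J D_J algebra_simps)
    qed
    show ?thesis
    proof (intro iffI allI impI ballI)
      fix \<alpha> \<beta> c x
      assume "holomorphic" and *: "one_form A \<alpha>" "one_form A \<beta>" "c \<in> A" "x \<in> chart_image c"
      then have "type20_germ.cauchy_riemann J0 x (\<pi>I c)"
        by (simp add: holomorphic_def)
      then have "?L \<alpha> \<beta> c x - ?R \<alpha> \<beta> c x = 0"
        by (intro blinfun_eqI) (simp only: eq[OF *] type20_germ.cauchy_riemann_def[OF germ[OF *(3,4)]]; simp)
      then show "?L \<alpha> \<beta> c x = ?R \<alpha> \<beta> c x"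
        by simp
    next
      assume *: "\<forall>\<alpha> \<beta>. one_form A \<alpha> \<longrightarrow> one_form A \<beta> \<longrightarrow> (\<forall>c\<in>A. \<forall>x\<in>chart_image c. ?L \<alpha> \<beta> c x = ?R \<alpha> \<beta> c x)"
      show holomorphic
        unfolding holomorphic_def
      proof (intro ballI)
        fix c x assume c: "c \<in> A" "x \<in> chart_image c"
        show "type20_germ.cauchy_riemann J0 x (\<pi>I c)"
          unfolding type20_germ.cauchy_riemann_def[OF germ[OF c]]
        proof (intro allI)
          fix u a b
          obtain \<alpha> \<beta> where form: "one_form A \<alpha>" "one_form A \<beta>" and val: "\<alpha> c x = a" "\<beta> c x = b"
            using one_form_with_value[OF A c] by metis
          from * form c have "?L \<alpha> \<beta> c x - ?R \<alpha> \<beta> c x = 0"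
            by simp
          then show "type20_germ.D x (\<pi>I c) (J0 u) a b = type20_germ.D x (\<pi>I c) u (a o\<^sub>L J0) b"
            using eq[OF form c, of u] by (simp add: val)
        qed
      qed
    qed
  qed
  ultimately show ?thesis
    unfolding poisson_nijenhuis_def poisson_bivector_field_def poisson_I_def using \<pi>I by blast
qed

abbreviation J_pi :: "('a, 'n) chart \<Rightarrow> complex ^ 'n \<Rightarrow> (complex ^ 'n) gen_endo" where
  "J_pi c x \<equiv> block_endo J0 (\<pi>I c x)"

lemma sharp_transport:
  assumes "c \<in> A" "d \<in> A" "x \<in> overlap c d"
  shows "sharp (\<pi>I d (transition c d x)) a = jac c d x (sharp (\<pi>I c x) (a o\<^sub>L jac c d x))"
proof (rule sharp_eqI)
  fix b :: "(complex ^ 'n) covector"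
  show "b (jac c d x (sharp (\<pi>I c x) (a o\<^sub>L jac c d x))) = \<pi>I d (transition c d x) a b"
    using sharp_apply[of "b o\<^sub>L jac c d x" "\<pi>I c x" "a o\<^sub>L jac c d x"] \<pi>I assms
    by (simp add: bivector_field_def)
qed

text \<open>
  The matrix is natural: \<open>J0\<close> and \<open>\<pi>I\<^sup>\<sharp>\<close> both commute with the derivatives of the transition maps.
\<close>

lemma gen_endo_field_block: "gen_endo_field A J_pi"
  unfolding gen_endo_field_def
proof (intro conjI ballI allI)
  fix c assume "c \<in> A"
  then show "smooth_on (chart_image c) (J_pi c)"
    using \<pi>I by (intro smooth_on_block_endo complex_manifoldD(2)[OF A]) (auto simp: bivector_field_def)
next
  fix c d x and u :: "(complex ^ 'n) \<times> (complex ^ 'n) covector"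
  assume *: "c \<in> A" "d \<in> A" "x \<in> overlap c d"
  have "snd u o\<^sub>L jac d c (transition c d x) o\<^sub>L jac c d x = snd u"
    by (rule blinfun_eqI) (simp add: jac_inverse(1)[OF A *])
  moreover have "jac d c (transition c d x) (J0 v) = J0 (jac d c (transition c d x) v)" for v
  proof (rule jac_J0[OF A *(2,1)])
    show "transition c d x \<in> overlap d c"
      using *(3) by (auto simp: overlap_def transition_chart[OF A *(1)])
  qed
  ultimately show "J_pi d (transition c d x) (gen_transport c d x u) = gen_transport c d x (J_pi c x u)"
    by (intro prod_eqI blinfun_eqI) (simp_all add: gen_transport_def block_endo_apply sharp_transport[OF *]
        jac_J0[OF A *] dual_map_apply blinfun.bilinear_simps)
qed

lemma gen_section_form:
  assumes "one_form A \<alpha>"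
  shows "gen_section A (\<lambda>c y. (0, \<alpha> c y))" "gen_section A (\<lambda>c y. - J_pi c y (0, \<alpha> c y))"
proof -
  show "gen_section A (\<lambda>c y. (0, \<alpha> c y))"
    using assms unfolding gen_section_def vector_field_def fst_conv snd_conv
    by (simp add: smooth_on_const blinfun.zero_right)
  have "vector_field A (\<lambda>c y. - sharp (\<pi>I c y) (\<alpha> c y))"
    unfolding vector_field_def
  proof (intro conjI ballI)
    fix c assume c: "c \<in> A"
    show "smooth_on (chart_image c) (\<lambda>y. - sharp (\<pi>I c y) (\<alpha> c y))"
      using \<pi>I assms c complex_manifoldD(2)[OF A c]
      by (intro smooth_on_bounded_linear[OF _ bounded_linear_minus[OF bounded_linear_ident]]
          smooth_on_bilinear[OF _ bounded_bilinear_sharp]) (auto simp: bivector_field_def one_form_def)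
  next
    fix c d x assume *: "c \<in> A" "d \<in> A" "x \<in> overlap c d"
    show "- sharp (\<pi>I d (transition c d x)) (\<alpha> d (transition c d x)) = jac c d x (- sharp (\<pi>I c x) (\<alpha> c x))"
      using assms * by (simp add: sharp_transport[OF *] one_form_def blinfun.bilinear_simps)
  qed
  moreover have "one_form A (\<lambda>c y. \<alpha> c y o\<^sub>L J0)"
    unfolding one_form_def
  proof (intro conjI ballI)
    fix c assume c: "c \<in> A"
    show "smooth_on (chart_image c) (\<lambda>y. \<alpha> c y o\<^sub>L J0)"
      using assms c complex_manifoldD(2)[OF A c]
      by (intro smooth_on_bounded_linear[OF _ bounded_bilinear.bounded_linear_left[OF bounded_bilinear_blinfun_compose]])
        (auto simp: one_form_def)
  next
    fix c d x assume *: "c \<in> A" "d \<in> A" "x \<in> overlap c d"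
    then have "\<alpha> c x = \<alpha> d (transition c d x) o\<^sub>L jac c d x"
      using assms by (simp add: one_form_def)
    then show "\<alpha> c x o\<^sub>L J0 = \<alpha> d (transition c d x) o\<^sub>L J0 o\<^sub>L jac c d x"
      by (intro blinfun_eqI) (simp add: jac_J0[OF A *])
  qed
  ultimately show "gen_section A (\<lambda>c y. - J_pi c y (0, \<alpha> c y))"
    by (simp add: gen_section_def block_endo_apply dual_map_apply blinfun.bilinear_simps)
qed

text \<open>
  These are the test sections that recover both pointwise conditions from closure under the Courant bracket:
  on sections without a tangent component the torsion already contains the Cauchy-Riemann defect and
  the Jacobi sum.
\<close>

lemma eigen_section_form:
  assumes "one_form A \<alpha>"
  shows "eigen_section A J_pi \<i> (\<lambda>c y. (0, \<alpha> c y), \<lambda>c y. - J_pi c y (0, \<alpha> c y))"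
proof -
  have "cx_map (J_pi c x) ((0, \<alpha> c x), - J_pi c x (0, \<alpha> c x)) = cx_scale \<i> ((0, \<alpha> c x), - J_pi c x (0, \<alpha> c x))"
    if "c \<in> A" "x \<in> chart_image c" for c x
    using type20_germ.cx_map_K_iff[OF germ[OF that] that(2), of 1 "(0, \<alpha> c x)" "- J_pi c x (0, \<alpha> c x)"]
    by (simp add: imaginary_unit.code)
  then show ?thesis
    by (simp add: eigen_section_def gen_section_form[OF assms])
qed

lemma generalized_complex_iff: "generalized_complex A J_pi \<longleftrightarrow> holomorphic \<and> poisson_I"
proof -
  let ?closed = "\<lambda>z s t c x. let b = cx_bilin (\<lambda>s t. courant_bracket s t x) (fst s c, snd s c) (fst t c, snd t c)
    in cx_map (J_pi c x) b = cx_scale z b"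
  have closed: "?closed (Complex 0 \<epsilon>) s t c x \<longleftrightarrow> type20_germ.torsion J0 x (\<pi>I c) (fst s c) (fst t c) = 0"
    if "eigen_section A J_pi (Complex 0 \<epsilon>) s" "eigen_section A J_pi (Complex 0 \<epsilon>) t" "\<epsilon> * \<epsilon> = 1"
      "c \<in> A" "x \<in> chart_image c" for \<epsilon> s t c x
  proof -
    interpret type20_germ J0 "chart_image c" x "\<pi>R c" "\<pi>I c"
      by (rule germ) fact+
    have "snd r c y = (- \<epsilon>) *\<^sub>R J_pi c y (fst r c y)"
      if "eigen_section A J_pi (Complex 0 \<epsilon>) r" "y \<in> chart_image c" for r y
    proof -
      have "cx_map (J_pi c y) (fst r c y, snd r c y) = cx_scale (Complex 0 \<epsilon>) (fst r c y, snd r c y)"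
        using that \<open>c \<in> A\<close> unfolding eigen_section_def by blast
      then show ?thesis
        by (rule cx_map_K_iff[OF that(2) \<open>\<epsilon> * \<epsilon> = 1\<close>, THEN iffD1])
    qed
    note s2 = this[OF that(1)] and t2 = this[OF that(2)]
    have gs: "gen_section A (fst s)" "gen_section A (fst t)"
      using that unfolding eigen_section_def by blast+
    show ?thesis
      by (rule courant_eigen_iff[OF gen_section_has_derivative[OF gs(1) that(4,5)]
            gen_section_has_derivative[OF gs(2) that(4,5)] that(3) s2 t2])
  qed
  have unit: "\<i> = Complex 0 1" "- \<i> = Complex 0 (- 1)"
    by (simp_all add: complex_eq_iff)
  have J_pi: "J_pi c x (J_pi c x u) = - u" "pairing (J_pi c x u) (J_pi c x w) = pairing u w"
    if "c \<in> A" "x \<in> chart_image c" for c x u w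
    using type20_germ.K_K[OF germ[OF that] that(2)] type20_germ.pairing_K_K[OF germ[OF that] that(2)] by auto
  show ?thesis
  proof
    assume "generalized_complex A J_pi"
    then have cl: "?closed \<i> s t c x"
      if "eigen_section A J_pi \<i> s" "eigen_section A J_pi \<i> t" "c \<in> A" "x \<in> chart_image c" for s t c x
      using that unfolding generalized_complex_def by blast
    have *: "type20_germ.cauchy_riemann J0 x (\<pi>I c) \<and> (\<forall>a b d. schouten (\<pi>I c) (\<pi>I c) x a b d = 0)"
      if c: "c \<in> A" "x \<in> chart_image c" for c x
    proof -
      interpret type20_germ J0 "chart_image c" x "\<pi>R c" "\<pi>I c"
        by (rule germ) fact+
      have ex: "\<exists>s t s' t'. (s has_derivative s') (at x) \<and> (t has_derivative t') (at x) \<and>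
          snd (s x) = a \<and> snd (t x) = b \<and> torsion s t = 0" for a b
      proof -
        obtain \<alpha> \<beta> where form: "one_form A \<alpha>" "one_form A \<beta>" and val: "\<alpha> c x = a" "\<beta> c x = b"
          using one_form_with_value[OF A c] by metis
        note eig = eigen_section_form[OF form(1)] eigen_section_form[OF form(2)]
        have "torsion (\<lambda>y. (0, \<alpha> c y)) (\<lambda>y. (0, \<beta> c y)) = 0"
          using cl[OF eig c] closed[OF eig[unfolded unit] _ c] by (simp add: unit)
        with val show ?thesis
          using gen_section_has_derivative[OF gen_section_form(1)[OF form(1)] c]
            gen_section_has_derivative[OF gen_section_form(1)[OF form(2)] c]
          by (intro exI[of _ "\<lambda>y. (0, \<alpha> c y)"] exI[of _ "\<lambda>y. (0, \<beta> c y)"] exI conjI) simp_all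
      qed
      have cauchy_riemann
        unfolding cauchy_riemann_def
      proof (intro allI)
        fix u a b
        from ex[of a b] obtain s t s' t' where "(s has_derivative s') (at x)" "(t has_derivative t') (at x)"
          and "snd (s x) = a" "snd (t x) = b" "torsion s t = 0"
          by blast
        then show "D (J0 u) a b = D u (a o\<^sub>L J0) b"
          using snd_torsion[of s s' t t' u] by (simp add: D_J)
      qed
      moreover have "schouten (\<pi>I c) (\<pi>I c) x a b d = 0" for a b d
      proof -
        from ex[of a b] obtain s t s' t' where "(s has_derivative s') (at x)" "(t has_derivative t') (at x)"
          and "snd (s x) = a" "snd (t x) = b" "torsion s t = 0"
          by blast
        then show ?thesis
          using torsion_eq_0_iff[of s s' t t'] \<open>cauchy_riemann\<close> by simp
      qed
      ultimately show ?thesis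
        by blast
    qed
    then show "holomorphic \<and> poisson_I"
      unfolding holomorphic_def poisson_I_def by blast
  next
    assume hp: "holomorphic \<and> poisson_I"
    have cl: "?closed (Complex 0 \<epsilon>) s t c x"
      if "\<epsilon> * \<epsilon> = 1" "eigen_section A J_pi (Complex 0 \<epsilon>) s" "eigen_section A J_pi (Complex 0 \<epsilon>) t"
        and c: "c \<in> A" "x \<in> chart_image c" for \<epsilon> s t c x
    proof -
      interpret type20_germ J0 "chart_image c" x "\<pi>R c" "\<pi>I c"
        by (rule germ) fact+
      have gs: "gen_section A (fst s)" "gen_section A (fst t)"
        using that unfolding eigen_section_def by blast+
      have cauchy_riemann and "\<forall>a b d. schouten (\<pi>I c) (\<pi>I c) x a b d = 0"
        using hp c unfolding holomorphic_def poisson_I_def by blast+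
      then have "torsion (fst s c) (fst t c) = 0"
        using torsion_eq_0_iff[OF gen_section_has_derivative[OF gs(1) c] gen_section_has_derivative[OF gs(2) c]]
        by blast
      then show ?thesis
        using closed that by blast
    qed
    have "?closed z s t c x"
      if "z \<in> {\<i>, - \<i>}" "eigen_section A J_pi z s" "eigen_section A J_pi z t" "c \<in> A" "x \<in> chart_image c"
      for z s t c x
    proof -
      from that(1) consider "z = Complex 0 1" | "z = Complex 0 (- 1)"
        by (auto simp: complex_eq_iff)
      then show ?thesis
        by cases (use that cl in simp_all)
    qed
    then show "generalized_complex A J_pi"
      unfolding generalized_complex_def using gen_endo_field_block J_pi by blast
  qed
qed

end

section \<open>The equivalence\<close>

theorem theorem2p7:
  fixes A :: "('a::{t2_space, second_countable_topology}, 'n::finite) chart set"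
    and \<pi>R \<pi>I :: "('a, 'n) chart \<Rightarrow> complex ^ 'n \<Rightarrow> (complex ^ 'n) bivector"
  assumes "complex_manifold A"
    and "bivector_field A \<pi>R"
    and "bivector_field A \<pi>I"
  shows "(holomorphic_poisson A (\<pi>R, \<pi>I) \<longleftrightarrow>
            poisson_nijenhuis A \<pi>I Jfield \<and>
            (\<forall>c\<in>A. \<forall>x\<in>chart_image c. \<forall>a.
              sharp (\<pi>R c x) a = sharp (\<pi>I c x) (dual_map (Jfield c x) a)))
       \<and> (holomorphic_poisson A (\<pi>R, \<pi>I) \<longleftrightarrow>
            generalized_complex A (\<lambda>c x. block_endo (Jfield c x) (\<pi>I c x)) \<and>
            (\<forall>c\<in>A. \<forall>x\<in>chart_image c. \<forall>a.
              sharp (\<pi>R c x) a = sharp (\<pi>I c x) (dual_map (Jfield c x) a)))"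
proof -
  let ?rel = "\<forall>c\<in>A. \<forall>x\<in>chart_image c. \<forall>a. sharp (\<pi>R c x) a = sharp (\<pi>I c x) (dual_map (Jfield c x) a)"
  have rel: "sharp R a = sharp I (dual_map J0 a) \<longleftrightarrow> (\<forall>b. R a b = I (a o\<^sub>L J0) b)"
    for R I :: "(complex ^ 'n) bivector" and a
  proof -
    have "sharp R a = sharp I (dual_map J0 a) \<longleftrightarrow>
        (\<forall>b :: (complex ^ 'n) covector. b (sharp R a) = b (sharp I (dual_map J0 a)))"
      by (auto intro: covectors_separate)
    then show ?thesis
      by (simp add: sharp_apply dual_map_apply)
  qed
  have type20: ?rel if "holomorphic_poisson A (\<pi>R, \<pi>I)"
  proof (intro ballI allI)
    fix c x a assume c: "c \<in> A" "x \<in> chart_image c"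
    with that have "(\<pi>R c x, \<pi>I c x) \<in> wedge2_T10 J0"
      by (simp add: holomorphic_poisson_def Jfield_def)
    then have "\<forall>a b. \<pi>R c x a b = \<pi>I c x (a o\<^sub>L J0) b"
      by (subst (asm) wedge2_T10_iff) (use assms(2,3) c in \<open>auto simp: J0_J0 bivector_field_def\<close>)
    then show "sharp (\<pi>R c x) a = sharp (\<pi>I c x) (dual_map (Jfield c x) a)"
      unfolding Jfield_def rel by blast
  qed
  have J: "(\<lambda>c x. block_endo (Jfield c x) (\<pi>I c x)) = (\<lambda>c x. block_endo J0 (\<pi>I c x))"
    by (simp add: Jfield_def)
  show ?thesis
  proof (cases ?rel)
    case True
    then have "type20_bivector A \<pi>R \<pi>I"
      using assms unfolding type20_bivector_def Jfield_def rel by blast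
    note iffs = this[THEN type20_bivector.holomorphic_poisson_iff] this[THEN type20_bivector.poisson_nijenhuis_iff]
      this[THEN type20_bivector.generalized_complex_iff]
    show ?thesis
      unfolding J iffs using True by blast
  next
    case False
    with type20 have "\<not> holomorphic_poisson A (\<pi>R, \<pi>I)"
      by blast
    with False show ?thesis
      by blast
  qed
qed

end
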